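(* Let $t$ be an arbitrary monotone, strict aggregation function with $m$ arguments. Let $\mathbf{D}$ be the class of all databases (with $m$ sorted lists). Let $\mathbf{A}$ be the class of all algorithms that correctly find the top $k$ objects for $t$ for every database and that do not make random accesses. Then the algorithm NRA is instance optimal over $\mathbf{A}$ and $\mathbf{D}$, with optimality ratio $m$. No deterministic algorithm has a lower optimality ratio (that is, no deterministic algorithm is instance optimal over $\mathbf A$ and $\mathbf D$ with optimality ratio less than $m$).
   Context: Setting: fix positive integers $m$ and $k$ (treated as constants). A database consists of a finite set of $N\ge k$ objects; each object $R$ has $m$ grades (fields) $x_1,\dots,x_m\in[0,1]$. It is presented as $m$ sorted lists $L_1,\dots,L_m$ of length $N$; list $L_i$ contains one entry $(R,x_i)$ for each object $R$, in descending order of $x_i$ (the order among ties is part of the database). An aggregation function is a fixed function $t:[0,1]^m\to[0,\infty)$; the overall grade of $R$ is $t(R)=t(x_1,\dots,x_m)$. $t$ is monotone if $t(x_1,\dots,x_m)\le t(x_1',\dots,x_m')$ whenever $x_i\le x_i'$ for every $i$. $t$ is strict if $t(x_1,\dots,x_m)=1$ holds precisely when $x_i=1$ for every $i$. Finding the top $k$ objects means outputting $k$ objects with the highest overall grades (ties broken arbitrarily); their grades and their relative order need not be output. Access and cost: an algorithm that makes no random accesses obtains information about the database only by sorted access (reading the next entry of some list, proceeding sequentially from the top). With $s$ sorted accesses its middleware cost is $s c_S$, where $c_S>0$ is a fixed constant; $cost(\mathcal A,\mathcal D)$ is the cost of algorithm $\mathcal A$ on database $\mathcal D$. Instance optimality: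 algorithm $\mathcal B$ is instance optimal over $\mathbf A$ and $\mathbf D$ with optimality ratio $c$ if $\mathcal B\in\mathbf A$ and there is a constant $c'$ such that $cost(\mathcal B,\mathcal D)\le c\cdot cost(\mathcal A,\mathcal D)+c'$ for every $\mathcal A\in\mathbf A$ and $\mathcal D\in\mathbf D$. Bounds: for an object $R$ with set $S\subseteq\{1,\dots,m\}$ of known fields, $W_S(R)$ is the value of $t$ obtained by using the known values for the fields in $S$ and $0$ for every other field; $B_S(R)$ is the value of $t$ obtained by using the known values for the fields in $S$ and $\underline{x}_i$ for every field $i\notin S$, where $\underline{x}_i$ (the bottom value) is the last value obtained under sorted access in $L_i$. Algorithm NRA: (1) Do sorted access in parallel to each of the lists. At each depth $d$ (when $d$ entries have been read in each list): maintain the bottom values $\underline{x}_i^{(d)}$; for every object $R$ with discovered fields $S=S^{(d)}(R)$ let $W^{(d)}(R)=W_S(R)$ and $B^{(d)}(R)=B_S(R)$ (for unseen $R$, $S=\emptyset$, so $W^{(d)}(R)=t(0,\dots,0)$ and $B^{(d)}(R)=t(\underline{x}_1^{(d)},\dots,\underline{x}_m^{(d)})$). Let $T_k^{(d)}$ contain the $k$ objects seen so far with the largest $W^{(d)}$ values, ties being broken in favor of the larger $B^{(d)}$ value (and arbitrarily if these also tie). Let $M_k^{(d)}$ be the $k$th largest $W^{(d)}$ value in $T_k^{(d)}$. (2) Halt when (a) at least $k$ distinct objects have been seen and (b) $B^{(d)}(R)\le M_k^{(d)}$ for all objects $R\notin T_k^{(d)}$. Return the objects in $T_k^{(d)}$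.
   Formalization: The claim that no deterministic algorithm has a ratio below m is stated only for m ≥ 2; for m = 1 it is false, since NRA always stops after exactly k sorted accesses and so has optimality ratio 0. *)

theory Defs
  imports "HOL-Probability.SPMF"
begin

section \<open>Databases and aggregation functions\<close>

text \<open>
  A database is the list of its \<open>m\<close> sorted lists; objects are drawn from a type \<open>'a\<close>.
  The order among ties is part of the lists.
\<close>

type_synonym 'a database = "('a \<times> real) list list"

definition objects :: "'a database \<Rightarrow> 'a set" where
  "objects D = (\<Union>L\<in>set D. fst ` set L)"

definition databases :: "nat \<Rightarrow> nat \<Rightarrow> 'a database set" where
  "databases m k = {D. length D = m \<and> k \<le> card (objects D) \<and>
     (\<forall>L\<in>set D. distinct (map fst L) \<and> fst ` set L = objects D \<and>
        snd ` set L \<subseteq> {0..1} \<and> sorted_wrt (\<lambda>e e'. snd e \<ge> snd e') L)}"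

definition grade_tuples :: "nat \<Rightarrow> real list set" where
  "grade_tuples m = {xs. length xs = m \<and> set xs \<subseteq> {0..1}}"

definition aggregation_function :: "nat \<Rightarrow> (real list \<Rightarrow> real) \<Rightarrow> bool" where
  "aggregation_function m t \<longleftrightarrow> (\<forall>xs\<in>grade_tuples m. 0 \<le> t xs)"

definition monotone_aggregation :: "nat \<Rightarrow> (real list \<Rightarrow> real) \<Rightarrow> bool" where
  "monotone_aggregation m t \<longleftrightarrow>
     (\<forall>xs\<in>grade_tuples m. \<forall>ys\<in>grade_tuples m. (\<forall>i<m. xs ! i \<le> ys ! i) \<longrightarrow> t xs \<le> t ys)"

definition strict_aggregation :: "nat \<Rightarrow> (real list \<Rightarrow> real) \<Rightarrow> bool" where
  "strict_aggregation m t \<longleftrightarrow>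
     (\<forall>xs\<in>grade_tuples m. t xs = 1 \<longleftrightarrow> (\<forall>i<m. xs ! i = 1))"

definition overall_grade :: "(real list \<Rightarrow> real) \<Rightarrow> 'a database \<Rightarrow> 'a \<Rightarrow> real" where
  "overall_grade t D R = t (map (\<lambda>L. the (map_of L R)) D)"

definition is_top :: "nat \<Rightarrow> (real list \<Rightarrow> real) \<Rightarrow> 'a database \<Rightarrow> 'a set \<Rightarrow> bool" where
  "is_top k t D Y \<longleftrightarrow> Y \<subseteq> objects D \<and> card Y = k \<and>
     (\<forall>R\<in>Y. \<forall>Q\<in>objects D - Y. overall_grade t D Q \<le> overall_grade t D R)"


section \<open>Algorithms that make no random accesses\<close>

text \<open>
  A history is the chronological list of the sorted accesses made so far, each recorded with the
  list accessed and the entry obtained (\<open>None\<close> if there was no further entry).  An algorithm is given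
  the number \<open>N\<close> of objects and chooses its next action from the history, possibly at random;
  nothing else about the database is available to it.  Since the history includes all previous
  actions, remembering earlier coin flips would add no generality.
\<close>

type_synonym 'a history = "(nat \<times> ('a \<times> real) option) list"

datatype 'a action = Access nat | Output "'a set"

type_synonym 'a algorithm = "nat \<Rightarrow> 'a history \<Rightarrow> 'a action pmf"

definition deterministic :: "'a algorithm \<Rightarrow> bool" where
  "deterministic A \<longleftrightarrow> (\<forall>N h. \<exists>a. A N h = return_pmf a)"

definition next_entry :: "'a database \<Rightarrow> 'a history \<Rightarrow> nat \<Rightarrow> ('a \<times> real) option" where
  "next_entry D h i = (let n = length (filter (\<lambda>e. fst e = i) h) in
     if i < length D \<and> n < length (D ! i) then Some (D ! i ! n) else None)"

text \<open>
  The sub-probability distribution of the final history and the output, starting from history \<open>h\<close>;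
  the missing mass is the probability of running forever.
\<close>

partial_function (spmf) run ::
  "'a algorithm \<Rightarrow> 'a database \<Rightarrow> 'a history \<Rightarrow> ('a history \<times> 'a set) spmf" where
  "run A D h = bind_spmf (spmf_of_pmf (A (card (objects D)) h))
     (\<lambda>a. case a of
        Access i \<Rightarrow> run A D (h @ [(i, next_entry D h i)])
      | Output Y \<Rightarrow> return_spmf (h, Y))"

text \<open>A correct algorithm halts almost surely and never makes a mistake.\<close>

definition correct_algorithms :: "nat \<Rightarrow> nat \<Rightarrow> (real list \<Rightarrow> real) \<Rightarrow> 'a algorithm set" where
  "correct_algorithms m k t = {A. \<forall>D\<in>databases m k.
     lossless_spmf (run A D []) \<and> (\<forall>(h, Y)\<in>set_spmf (run A D []). is_top k t D Y)}"

text \<open>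
  The expected middleware cost, for algorithms that halt almost surely (otherwise the runs that do
  not halt would be ignored).  For a deterministic algorithm this is \<open>cS\<close> times the number of
  accesses.
\<close>

definition cost :: "real \<Rightarrow> 'a algorithm \<Rightarrow> 'a database \<Rightarrow> ennreal" where
  "cost cS A D = (\<integral>\<^sup>+ (h, Y). ennreal (real (length h) * cS) \<partial>measure_spmf (run A D []))"

text \<open>The embedding \<open>ennreal\<close> sends negative constants to \<open>0\<close>.\<close>

definition instance_optimal ::
  "('alg \<Rightarrow> 'db \<Rightarrow> ennreal) \<Rightarrow> 'alg set \<Rightarrow> 'db set \<Rightarrow> real \<Rightarrow> 'alg \<Rightarrow> bool" where
  "instance_optimal cst As Ds c B \<longleftrightarrow> B \<in> As \<and>
     (\<exists>c'::real. \<forall>A\<in>As. \<forall>D\<in>Ds. cst B D \<le> ennreal c * cst A D + ennreal c')"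


section \<open>The algorithm NRA\<close>

definition entries :: "'a history \<Rightarrow> nat \<Rightarrow> ('a \<times> real) list" where
  "entries h i = List.map_filter (\<lambda>(j, r). if j = i then r else None) h"

definition seen :: "'a history \<Rightarrow> 'a set" where
  "seen h = {R. \<exists>i x. (i, Some (R, x)) \<in> set h}"

definition bottom :: "'a history \<Rightarrow> nat \<Rightarrow> real" where
  "bottom h i = snd (last (entries h i))"

definition W_bound :: "nat \<Rightarrow> (real list \<Rightarrow> real) \<Rightarrow> 'a history \<Rightarrow> 'a \<Rightarrow> real" where
  "W_bound m t h R =
     t (map (\<lambda>i. case map_of (entries h i) R of Some x \<Rightarrow> x | None \<Rightarrow> 0) [0..<m])"

definition B_bound :: "nat \<Rightarrow> (real list \<Rightarrow> real) \<Rightarrow> 'a history \<Rightarrow> 'a \<Rightarrow> real" where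
  "B_bound m t h R =
     t (map (\<lambda>i. case map_of (entries h i) R of Some x \<Rightarrow> x | None \<Rightarrow> bottom h i) [0..<m])"

definition is_T :: "nat \<Rightarrow> nat \<Rightarrow> (real list \<Rightarrow> real) \<Rightarrow> 'a history \<Rightarrow> 'a set \<Rightarrow> bool" where
  "is_T m k t h T \<longleftrightarrow> T \<subseteq> seen h \<and> card T = k \<and>
     (\<forall>R\<in>T. \<forall>Q\<in>seen h - T. W_bound m t h Q < W_bound m t h R \<or>
        W_bound m t h Q = W_bound m t h R \<and> B_bound m t h Q \<le> B_bound m t h R)"

text \<open>
  Ties in both \<open>W\<close> and \<open>B\<close> are broken arbitrarily; \<open>T N h\<close> is the current top \<open>k\<close> list after
  history \<open>h\<close>, for databases of size \<open>N\<close>.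
\<close>

definition T_rule ::
  "nat \<Rightarrow> nat \<Rightarrow> (real list \<Rightarrow> real) \<Rightarrow> (nat \<Rightarrow> 'a history \<Rightarrow> 'a set) \<Rightarrow> bool" where
  "T_rule m k t T \<longleftrightarrow> (\<forall>N h. k \<le> card (seen h) \<longrightarrow> is_T m k t h (T N h))"

text \<open>
  The last condition covers the unseen objects, which exist iff fewer than \<open>N\<close> objects have been
  seen and all have the bound \<open>B = t (bottom values)\<close>.  As \<open>T\<close> has \<open>k\<close> elements, the \<open>k\<close>th largest
  \<open>W\<close> value in it is the minimum.
\<close>

definition NRA_halts ::
  "nat \<Rightarrow> nat \<Rightarrow> (real list \<Rightarrow> real) \<Rightarrow> nat \<Rightarrow> 'a history \<Rightarrow> 'a set \<Rightarrow> bool" where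
  "NRA_halts m k t N h T \<longleftrightarrow> k \<le> card (seen h) \<and>
     (let M = Min (W_bound m t h ` T) in
        (\<forall>R\<in>seen h - T. B_bound m t h R \<le> M) \<and>
        (card (seen h) < N \<longrightarrow> t (map (bottom h) [0..<m]) \<le> M))"

text \<open>
  Sorted access in parallel is done round-robin, and the halting test is made only when all \<open>m\<close>
  lists have been read to the same depth.
\<close>

definition NRA ::
  "nat \<Rightarrow> nat \<Rightarrow> (real list \<Rightarrow> real) \<Rightarrow> (nat \<Rightarrow> 'a history \<Rightarrow> 'a set) \<Rightarrow> 'a algorithm" where
  "NRA m k t T = (\<lambda>N h. return_pmf
     (if m dvd length h \<and> NRA_halts m k t N h (T N h) then Output (T N h)
      else Access (length h mod m)))"

end

theory Submission
  imports Defs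
begin

text \<open>
  An output of a correct algorithm is a top \<open>k\<close> set for every database that is consistent with the
  history, and hence also for every database that is consistent with NRA's history once NRA has read
  each list at least as far.  If NRA has not halted there, some \<open>R\<close> outside the output has a
  bound \<open>B\<close> exceeding the bound \<open>W\<close> of some \<open>Q\<close> in the output, and both bounds are attained in a
  single consistent database: \<open>R\<close> comes next, with the bottom value, in each list where it is
  missing, and all other unseen grades are \<open>0\<close>.  So NRA halts at a depth of at most the number of
  accesses made by the other algorithm, or at depth \<open>1\<close>.

  For the lower bound, the last winner is at the top of all lists except one, where it is hidden
  behind \<open>q\<close> objects that look equally good there.  An algorithm that guesses this list needs
  \<open>q + O(1)\<close> accesses; a deterministic algorithm can be forced to find it last and needs at least
  \<open>m * q\<close>.
\<close>

section \<open>Histories and runs\<close>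

definition consistent :: "'a database \<Rightarrow> 'a history \<Rightarrow> bool" where
  "consistent D h \<longleftrightarrow> (\<forall>n<length h. snd (h ! n) = next_entry D (take n h) (fst (h ! n)))"

definition accesses :: "'a history \<Rightarrow> nat \<Rightarrow> nat" where
  "accesses h i = length (filter (\<lambda>e. fst e = i) h)"

text \<open>This is what a correct algorithm must have established when it outputs \<open>Y\<close>.
  The size \<open>N\<close> is fixed because algorithms are told it.\<close>

definition certifies ::
  "nat \<Rightarrow> nat \<Rightarrow> (real list \<Rightarrow> real) \<Rightarrow> nat \<Rightarrow> 'a history \<Rightarrow> 'a set \<Rightarrow> bool" where
  "certifies m k t N h Y \<longleftrightarrow>
     (\<forall>D\<in>databases m k. card (objects D) = N \<and> consistent D h \<longrightarrow> is_top k t D Y)"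

lemma consistent_Nil [simp]: "consistent D []"
  by (simp add: consistent_def)

lemma accesses_Nil [simp]: "accesses [] i = 0"
  by (simp add: accesses_def)

lemma accesses_append [simp]: "accesses (h @ h') i = accesses h i + accesses h' i"
  by (simp add: accesses_def)

lemma accesses_Cons [simp]: "accesses (e # h) i = (if fst e = i then 1 else 0) + accesses h i"
  by (simp add: accesses_def)

lemma accesses_le_length: "accesses h i \<le> length h"
  by (simp add: accesses_def)

lemma accesses_take_le: "accesses (take n h) i \<le> accesses h i"
  by (metis accesses_append append_take_drop_id le_add1)

lemma sum_accesses_le_length: "(\<Sum>i<m. accesses h i) \<le> length h"
proof (induction h)
  case (Cons e h)
  have "(\<Sum>i<m. if fst e = i then 1 else 0::nat) \<le> 1"
    by (simp add: sum.delta')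
  with Cons show ?case by (simp add: sum.distrib)
qed simp

lemma consistent_snoc:
  "consistent D (h @ [(i, r)]) \<longleftrightarrow> consistent D h \<and> r = next_entry D h i"
  by (auto simp: consistent_def nth_append less_Suc_eq)

lemma consistent_take: "consistent D h \<Longrightarrow> consistent D (take n h)"
  by (auto simp: consistent_def min_def)

lemma next_entry_eq:
  "next_entry D h i =
     (if i < length D \<and> accesses h i < length (D ! i) then Some (D ! i ! accesses h i) else None)"
  by (simp add: next_entry_def accesses_def Let_def)

lemma entries_Nil [simp]: "entries [] i = []"
  by (simp add: entries_def map_filter_def)

lemma entries_snoc [simp]:
  "entries (h @ [(j, r)]) i = entries h i @ (if j = i then (case r of None \<Rightarrow> [] | Some e \<Rightarrow> [e]) else [])"
  by (auto simp: entries_def map_filter_def split: option.splits)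

lemma entries_consistent:
  assumes "consistent D h"
  shows "entries h i = (if i < length D then take (accesses h i) (D ! i) else [])"
  using assms
proof (induction h rule: rev_induct)
  case (snoc e h)
  obtain j r where e: "e = (j, r)" by (cases e)
  from snoc.prems have "consistent D h" and r: "r = next_entry D h j"
    by (simp_all add: e consistent_snoc)
  with snoc.IH show ?case
    by (auto simp: e next_entry_eq take_Suc_conv_app_nth)
qed auto

lemma in_set_entries_iff: "e \<in> set (entries h i) \<longleftrightarrow> (i, Some e) \<in> set h"
  by (force simp: entries_def map_filter_def image_iff split: prod.splits if_splits)

lemma seen_consistent:
  assumes "consistent D h"
  shows "seen h = (\<Union>i<length D. fst ` set (take (accesses h i) (D ! i)))"
proof -
  have "R \<in> seen h \<longleftrightarrow> (\<exists>i. R \<in> fst ` set (entries h i))" for R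
    unfolding seen_def by (force simp: in_set_entries_iff)
  then show ?thesis by (fastforce simp: entries_consistent [OF assms] split: if_splits)
qed

text \<open>A history inspects only the first \<open>accesses h i\<close> entries of list
  \<open>i\<close>, so replacing unread tails goes unnoticed. The alternative databases of the
  adversary arguments are justified by this.\<close>

lemma consistent_agree:
  assumes "consistent D h" "length D' = length D"
    and "\<And>i. i < length D \<Longrightarrow> take (accesses h i) (D' ! i) = take (accesses h i) (D ! i)"
  shows "consistent D' h"
  using assms(1,3)
proof (induction h rule: rev_induct)
  case (snoc e h)
  obtain j r where e: "e = (j, r)" by (cases e)
  from snoc.prems have h: "consistent D h" and r: "r = next_entry D h j"
    by (simp_all add: e consistent_snoc)
  have t: "take (accesses h i + (if j = i then 1 else 0)) (D' ! i) =
     take (accesses h i + (if j = i then 1 else 0)) (D ! i)" if "i < length D" for i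
    using snoc.prems(2)[OF that] by (simp add: e)
  have "take (accesses h i) (D' ! i) = take (accesses h i) (D ! i)" if "i < length D" for i
    using arg_cong [OF t[OF that], of "take (accesses h i)"] by simp
  with h have "consistent D' h" by (rule snoc.IH)
  moreover have "next_entry D' h j = next_entry D h j"
  proof (cases "j < length D")
    case True
    let ?n = "accesses h j"
    \<comment> \<open>Prefixes of length \<open>Suc ?n\<close> also show whether there is an entry
      at position \<open>?n\<close>, so an access that yields \<open>None\<close> is reproduced
      too.\<close>
    have t': "take (Suc ?n) (D' ! j) = take (Suc ?n) (D ! j)" using t[OF True] by simp
    have l: "?n < length (D' ! j) \<longleftrightarrow> ?n < length (D ! j)"
      using arg_cong [OF t', of length] by auto
    have "D' ! j ! ?n = D ! j ! ?n"
      using arg_cong [OF t', of "\<lambda>xs. xs ! ?n"] by simp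
    with l assms(2) show ?thesis by (simp add: next_entry_eq)
  qed (use assms(2) in \<open>simp add: next_entry_eq\<close>)
  ultimately show ?case using r by (simp add: e consistent_snoc)
qed simp

text \<open>What a history reveals about \<open>D\<close> depends only on how deep each list was
  read, not on the order of accesses. Hence every database that fits \<open>h'\<close> also fits
  \<open>h\<close>.\<close>

lemma certifies_mono:
  assumes "certifies m k t N h Y" and "D \<in> databases m k" "consistent D h" "consistent D h'"
    and "\<And>i. i < m \<Longrightarrow> accesses h i \<le> accesses h' i"
  shows "certifies m k t N h' Y"
  unfolding certifies_def
proof (intro ballI impI, elim conjE)
  fix D' assume D': "D' \<in> databases m k" "card (objects D') = N" "consistent D' h'"
  have l: "length D = m" "length D' = m" using assms(2) D'(1) by (auto simp: databases_def)
  have "consistent D' h"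
  proof (rule consistent_agree [OF assms(3)])
    fix i assume "i < length D"
    then have i: "i < m" using l by simp
    have "take (accesses h' i) (D' ! i) = take (accesses h' i) (D ! i)"
      using entries_consistent [OF D'(3), of i] entries_consistent [OF assms(4), of i] i l by simp
    from arg_cong [OF this, of "take (accesses h i)"] assms(5) [OF i]
    show "take (accesses h i) (D' ! i) = take (accesses h i) (D ! i)" by (simp add: min_def)
  qed (use l in simp)
  then show "is_top k t D' Y" using assms(1) D' by (auto simp: certifies_def)
qed

text \<open>In the lower bound this dates the access that uncovers the hidden winner;
  \<open>c\<close> counts from \<open>0\<close>.\<close>

lemma ex_access:
  "c < accesses h i \<Longrightarrow> \<exists>n<length h. fst (h ! n) = i \<and> accesses (take n h) i = c"
proof (induction h rule: rev_induct)
  case (snoc e h)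
  show ?case
  proof (cases "c < accesses h i")
    case True
    then obtain n where "n < length h" "fst (h ! n) = i" "accesses (take n h) i = c"
      using snoc.IH by blast
    then show ?thesis by (intro exI [of _ n]) (auto simp: nth_append)
  next
    case False
    with snoc.prems have "fst e = i" "accesses h i = c" by (auto split: if_splits)
    then show ?thesis by (intro exI [of _ "length h"]) auto
  qed
qed simp

section \<open>The support of a run\<close>

definition follows :: "'a algorithm \<Rightarrow> nat \<Rightarrow> 'a history \<Rightarrow> bool" where
  "follows A N h \<longleftrightarrow> (\<forall>n<length h. Access (fst (h ! n)) \<in> set_pmf (A N (take n h)))"

lemma follows_snoc:
  "follows A N (h @ [(i, r)]) \<longleftrightarrow> follows A N h \<and> Access i \<in> set_pmf (A N h)"
  by (auto simp: follows_def nth_append less_Suc_eq)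

text \<open>Fixed-point induction works because the support of the limit of a chain is the union of
  the supports. The quantifiers are kept inside the formula so that the hypothesis applies to the
  extended history.\<close>

lemma set_run_subset:
  "\<forall>(A :: 'a algorithm) D h0 h Y. (h, Y) \<in> set_spmf (run A D h0) \<longrightarrow> consistent D h0 \<longrightarrow> follows A (card (objects D)) h0 \<longrightarrow>
   consistent D h \<and> follows A (card (objects D)) h \<and> Output Y \<in> set_pmf (A (card (objects D)) h)"
proof (induction rule: run.fixp_induct)
  case 1
  have "ccpo.admissible lub_spmf (ord_spmf (=)) (\<lambda>p. \<forall>h Y. (h, Y) \<in> set_spmf p \<longrightarrow> Q h Y)" for Q :: "'a history \<Rightarrow> 'a set \<Rightarrow> bool"
    by (rule ccpo.admissibleI) (auto simp: set_lub_spmf)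
  then have "ccpo.admissible lub_spmf (ord_spmf (=)) (case x of ((A, D), h0) \<Rightarrow> \<lambda>p. \<forall>h Y. (h, Y) \<in> set_spmf p \<longrightarrow>
    consistent D h0 \<longrightarrow> follows A (card (objects D)) h0 \<longrightarrow>
    consistent D h \<and> follows A (card (objects D)) h \<and> Output Y \<in> set_pmf (A (card (objects D)) h))"
    for x :: "('a algorithm \<times> 'a database) \<times> 'a history"
    by (auto split: prod.split)
  from admissible_fun [OF partial_function_definitions_spmf this]
  show ?case by (simp add: curry_def)
next
  case 2
  then show ?case by simp
next
  case (3 run')
  show ?case
  proof (intro allI impI)
    fix A :: "'a algorithm" and D :: "'a database" and h0 h Y
    let ?N = "card (objects D)"
    assume h0: "consistent D h0" "follows A ?N h0"
      and "(h, Y) \<in> set_spmf (spmf_of_pmf (A ?N h0) \<bind> (\<lambda>a. case a of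
            Access i \<Rightarrow> run' A D (h0 @ [(i, next_entry D h0 i)]) | Output Y \<Rightarrow> return_spmf (h0, Y)))"
    then obtain a where a: "a \<in> set_pmf (A ?N h0)"
      and r: "(h, Y) \<in> set_spmf (case a of
            Access i \<Rightarrow> run' A D (h0 @ [(i, next_entry D h0 i)]) | Output Y \<Rightarrow> return_spmf (h0, Y))"
      by (auto simp: set_bind_spmf bind_UNION simp del: bind_spmf_of_pmf)
    show "consistent D h \<and> follows A ?N h \<and> Output Y \<in> set_pmf (A ?N h)"
    proof (cases a)
      case (Access i)
      with a h0 r show ?thesis
        using 3 [rule_format, of h Y A D "h0 @ [(i, next_entry D h0 i)]"]
        by (simp add: consistent_snoc follows_snoc)
    qed (use a h0 r in auto)
  qed
qed

text \<open>A reachability claim fails for the bottom element, so fixed-point induction is no use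
  here; the recursion is unfolded along the remaining history \<open>h\<close> instead.\<close>

lemma set_run_superset:
  "consistent D (h0 @ h) \<Longrightarrow> follows A (card (objects D)) (h0 @ h) \<Longrightarrow>
   Output Y \<in> set_pmf (A (card (objects D)) (h0 @ h)) \<Longrightarrow> (h0 @ h, Y) \<in> set_spmf (run A D h0)"
proof (induction h arbitrary: h0)
  case Nil
  then show ?case
    by (subst run.simps) (auto simp: set_bind_spmf bind_UNION simp del: bind_spmf_of_pmf intro!: bexI [of _ "Output Y"])
next
  case (Cons e h)
  obtain i r where e: "e = (i, r)" by (cases e)
  let ?N = "card (objects D)"
  have "consistent D (h0 @ [e])" "follows A ?N (h0 @ [e])"
    using consistent_take [OF Cons.prems(1), of "Suc (length h0)"] Cons.prems(2)
    by (auto simp: follows_def nth_append less_Suc_eq split: if_splits)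
  then have "r = next_entry D h0 i" "Access i \<in> set_pmf (A ?N h0)"
    by (auto simp: e consistent_snoc follows_snoc)
  moreover have "(h0 @ e # h, Y) \<in> set_spmf (run A D (h0 @ [e]))"
    using Cons.IH [of "h0 @ [e]"] Cons.prems by simp
  ultimately show ?case
    by (subst run.simps) (auto simp: set_bind_spmf bind_UNION e simp del: bind_spmf_of_pmf intro!: bexI [of _ "Access i"])
qed

text \<open>This separates two influences: the database enters only through
  \<open>consistent\<close> and the number of objects, the algorithm only through the choices it
  makes with positive probability.\<close>

lemma set_run_iff:
  "(h, Y) \<in> set_spmf (run A D []) \<longleftrightarrow> consistent D h \<and> follows A (card (objects D)) h \<and>
     Output Y \<in> set_pmf (A (card (objects D)) h)"
proof
  show "(h, Y) \<in> set_spmf (run A D []) \<Longrightarrow> consistent D h \<and> follows A (card (objects D)) h \<and>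
     Output Y \<in> set_pmf (A (card (objects D)) h)"
    using set_run_subset by (fastforce simp: follows_def)
qed (use set_run_superset [of D "[]" h A Y] in auto)

lemma lossless_support:
  assumes "lossless_spmf p"
  shows "\<exists>x. x \<in> set_spmf p"
proof -
  obtain y where "y \<in> set_pmf p" using set_pmf_not_empty by fast
  moreover from this have "y \<noteq> None" using assms unfolding lossless_iff_set_pmf_None by metis
  ultimately show ?thesis by (cases y) (auto simp: in_set_spmf)
qed

text \<open>On any database of the same size that fits \<open>h\<close>, the same outcome has
  positive probability, and a correct algorithm errs with probability zero.\<close>

lemma run_certifies:
  assumes A: "A \<in> correct_algorithms m k t" and D: "D \<in> databases m k"
    and r: "(h, Y) \<in> set_spmf (run A D [])"
  shows "certifies m k t (card (objects D)) h Y"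
proof -
  have "(h, Y) \<in> set_spmf (run A D' [])" if "consistent D' h" "card (objects D') = card (objects D)" for D'
    using r that by (simp add: set_run_iff)
  then show ?thesis
    using A unfolding correct_algorithms_def certifies_def by blast
qed

text \<open>A bound for every possible outcome is integrated; almost sure halting makes the total
  mass \<open>1\<close>, so constants integrate to themselves. This is how randomised competitors
  are handled.\<close>

lemma cost_ge:
  fixes x c c' cS :: real
  assumes "lossless_spmf (run A D [])" and "0 \<le> cS" and c: "0 \<le> c"
    and "\<And>h Y. (h, Y) \<in> set_spmf (run A D []) \<Longrightarrow> x \<le> c * (length h * cS) + c'"
    and "0 \<le> c'"
  shows "ennreal x \<le> ennreal c * cost cS A D + ennreal c'"
proof -
  let ?M = "measure_spmf (run A D [])"
  have M: "emeasure ?M (space ?M) = 1"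
    using assms(1) by (simp add: lossless_spmf_def measure_spmf.emeasure_eq_measure weight_spmf_def)
  have "ennreal x = (\<integral>\<^sup>+ _. ennreal x \<partial>?M)" using M by simp
  also have "\<dots> \<le> (\<integral>\<^sup>+ hY. (case hY of (h, Y) \<Rightarrow> ennreal c * ennreal (length h * cS)) + ennreal c' \<partial>?M)"
    using assms(2-) 
    by (intro nn_integral_mono_AE) (auto simp flip: ennreal_mult ennreal_plus intro!: ennreal_leI)
  also have "\<dots> = (\<integral>\<^sup>+ hY. ennreal c * (case hY of (h, Y) \<Rightarrow> ennreal (length h * cS)) \<partial>?M) + ennreal c'"
    using M by (subst nn_integral_add) (auto simp: case_prod_unfold)
  also have "\<dots> = ennreal c * cost cS A D + ennreal c'"
    by (simp add: cost_def nn_integral_cmult)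
  finally show ?thesis .
qed

section \<open>Algorithms whose order of accesses is fixed in advance\<close>

fun static_history :: "'a database \<Rightarrow> (nat \<Rightarrow> nat) \<Rightarrow> nat \<Rightarrow> 'a history" where
  "static_history D f 0 = []"
| "static_history D f (Suc n) =
     static_history D f n @ [(f n, next_entry D (static_history D f n) (f n))]"

lemma length_static_history [simp]: "length (static_history D f n) = n"
  by (induction n) auto

lemma consistent_static_history: "consistent D (static_history D f n)"
  by (induction n) (auto simp: consistent_snoc)

lemma accesses_static_history: "accesses (static_history D f n) i = card {j. j < n \<and> f j = i}"
proof (induction n)
  case (Suc n)
  have "{j. j < Suc n \<and> f j = i} = {j. j < n \<and> f j = i} \<union> (if f n = i then {n} else {})"
    by (auto simp: less_Suc_eq)
  then show ?case by (auto simp: Suc)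
qed simp

lemma run_static:
  assumes A: "\<And>h. A (card (objects D)) h =
      return_pmf (if stop h then Output (out h) else Access (f (length h)))"
    and n: "stop (static_history D f n)"
  shows "run A D [] = (let h = static_history D f (LEAST n. stop (static_history D f n))
     in return_spmf (h, out h))"
proof -
  define l where "l = (LEAST n. stop (static_history D f n))"
  have l: "stop (static_history D f l)" unfolding l_def by (rule LeastI) (rule n)
  have nl: "\<not> stop (static_history D f j)" if "j < l" for j
    using that not_less_Least unfolding l_def by blast
  have "run A D (static_history D f 0) = return_spmf (static_history D f l, out (static_history D f l))"
  \<comment> \<open>\<open>run\<close> unfolds forwards, so the induction goes backwards from the
    halting time \<open>l\<close>.\<close>
  proof (rule inc_induct [of 0 l])
    show "run A D (static_history D f l) = return_spmf (static_history D f l, out (static_history D f l))"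
      by (subst run.simps) (simp add: A l)
    fix j assume "j < l" and IH: "run A D (static_history D f (Suc j)) =
      return_spmf (static_history D f l, out (static_history D f l))"
    then show "run A D (static_history D f j) = return_spmf (static_history D f l, out (static_history D f l))"
      by (subst run.simps) (simp add: A nl)
  qed simp
  then show ?thesis by (simp add: l_def Let_def)
qed

lemma cost_static:
  assumes A: "\<And>h. A (card (objects D)) h =
      return_pmf (if stop h then Output (out h) else Access (f (length h)))"
    and n: "stop (static_history D f n)" and "0 \<le> cS"
  shows "cost cS A D \<le> ennreal (n * cS)"
proof -
  have "(LEAST n. stop (static_history D f n)) \<le> n" by (rule Least_le) (rule n)
  then show ?thesis
    using \<open>0 \<le> cS\<close> by (simp add: cost_def run_static [of A D stop out f n, OF A n] Let_def measure_spmf_return_spmf nn_integral_return ennreal_leI mult_right_mono)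
qed

section \<open>Databases and certificates\<close>

definition sorted_list :: "'a set \<Rightarrow> ('a \<times> real) list \<Rightarrow> bool" where
  "sorted_list S L \<longleftrightarrow> distinct (map fst L) \<and> fst ` set L = S \<and>
     snd ` set L \<subseteq> {0..1} \<and> sorted_wrt (\<lambda>e e'. snd e \<ge> snd e') L"

lemma databasesD:
  assumes "D \<in> databases m k"
  shows "length D = m" "k \<le> card (objects D)" "finite (objects D)"
    and "\<And>i. i < m \<Longrightarrow> sorted_list (objects D) (D ! i)"
proof -
  show "finite (objects D)" by (simp add: objects_def)
qed (use assms in \<open>auto simp: databases_def sorted_list_def\<close>)

lemma databasesI:
  assumes "length D = m" "0 < m" "k \<le> card S" "\<And>i. i < m \<Longrightarrow> sorted_list S (D ! i)"
  shows "D \<in> databases m k" "objects D = S"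
proof -
  have s: "sorted_list S L" if "L \<in> set D" for L
    using that assms by (auto simp: in_set_conv_nth)
  then have "(\<Union>L\<in>set D. fst ` set L) = (\<Union>L\<in>set D. S)"
    by (intro SUP_cong) (auto simp: sorted_list_def)
  moreover have "set D \<noteq> {}" using assms by auto
  ultimately show "objects D = S" by (simp add: objects_def)
  with s assms show "D \<in> databases m k" by (simp add: databases_def sorted_list_def)
qed

lemma length_sorted_list: "sorted_list S L \<Longrightarrow> length L = card S"
  by (metis sorted_list_def distinct_card length_map list.set_map)

lemma overall_grade_nth:
  "length D = m \<Longrightarrow> overall_grade t D R = t (map (\<lambda>i. the (map_of (D ! i) R)) [0..<m])"
  unfolding overall_grade_def by (rule arg_cong [of _ _ t], rule nth_equalityI) auto

lemma sorted_list_value: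
  assumes "sorted_list S L" "R \<in> S"
  obtains x where "map_of L R = Some x" "0 \<le> x" "x \<le> 1"
proof -
  have "map_of L R \<noteq> None" using assms by (simp add: sorted_list_def map_of_eq_None_iff)
  then obtain x where x: "map_of L R = Some x" by auto
  then have "(R, x) \<in> set L" by (rule map_of_SomeD)
  then have "x \<in> {0..1}" using assms(1) by (force simp: sorted_list_def)
  with x that show thesis by auto
qed

lemma map_of_take: "map_of (take n L) R = Some x \<Longrightarrow> map_of L R = Some x"
  by (metis append_take_drop_id map_add_find_right map_of_append)

lemma sorted_list_bottom:
  assumes L: "sorted_list S L" and "R \<in> S" "0 < n"
  shows "0 \<le> snd (last (take n L))" "snd (last (take n L)) \<le> 1"
    and "map_of (take n L) R = None \<Longrightarrow> the (map_of L R) \<le> snd (last (take n L))"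
proof -
  have ne: "take n L \<noteq> []" using assms by (auto simp: sorted_list_def)
  then have "last (take n L) \<in> set L" by (meson in_set_takeD last_in_set)
  with L show "0 \<le> snd (last (take n L))" "snd (last (take n L)) \<le> 1"
    by (auto simp: sorted_list_def)
  assume N: "map_of (take n L) R = None"
  obtain x where x: "map_of L R = Some x" using sorted_list_value assms by metis
  then have "(R, x) \<in> set (take n L @ drop n L)" by (simp add: map_of_SomeD)
  moreover have "(R, x) \<notin> set (take n L)"
    using N unfolding map_of_eq_None_iff by (metis fst_conv image_eqI)
  ultimately have "(R, x) \<in> set (drop n L)" unfolding set_append by blast
  moreover have "sorted_wrt (\<lambda>e e'. snd e \<ge> snd e') (take n L @ drop n L)"
    using L by (simp add: sorted_list_def)
  ultimately show "the (map_of L R) \<le> snd (last (take n L))"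
    using last_in_set [OF ne] unfolding sorted_wrt_append by (force simp: x)
qed

text \<open>The list that is most favourable to \<open>R\<close> and least favourable to all other objects, given
  the first \<open>n\<close> entries.\<close>

definition completion :: "nat \<Rightarrow> 'a \<Rightarrow> ('a \<times> real) list \<Rightarrow> ('a \<times> real) list" where
  "completion n R L = take n L @
     (if R \<in> fst ` set (take n L) then [] else [(R, snd (last (take n L)))]) @
     map (\<lambda>X. (X, 0)) (filter (\<lambda>X. X \<noteq> R) (map fst (drop n L)))"

text \<open>Every read entry is at least the bottom value, so placing \<open>R\<close> there right
  after the prefix keeps the list descending, and so do zeros after it. The best case for
  \<open>R\<close> and the worst case for all others thus occur together.\<close>

lemma completion:
  assumes L: "sorted_list S L" and R: "R \<in> S" and n: "0 < n"
  shows sorted_list_completion: "sorted_list S (completion n R L)"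
    and take_completion: "take n (completion n R L) = take n L"
    and completion_target: "the (map_of (completion n R L) R) =
      (case map_of (take n L) R of Some x \<Rightarrow> x | None \<Rightarrow> snd (last (take n L)))"
    and completion_other: "Q \<in> S \<Longrightarrow> Q \<noteq> R \<Longrightarrow> the (map_of (completion n R L) Q) =
      (case map_of (take n L) Q of Some x \<Rightarrow> x | None \<Rightarrow> 0)"
proof -
  have ne: "take n L \<noteq> []" using assms by (auto simp: sorted_list_def)
  have L': "sorted_list S (take n L @ drop n L)" using L by simp
  have S: "S = fst ` set (take n L) \<union> fst ` set (drop n L)"
    using L' by (auto simp: sorted_list_def simp del: append_take_drop_id)
  note b = sorted_list_bottom [OF assms]
  have v: "snd e \<in> {0..1}" if "e \<in> set (take n L)" for e
    using L in_set_takeD [OF that] unfolding sorted_list_def by blast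
  have d: "distinct (map fst (take n L))" "distinct (map fst (drop n L))"
    "fst ` set (take n L) \<inter> fst ` set (drop n L) = {}"
    using L' unfolding sorted_list_def map_append distinct_append by auto
  have s: "sorted_wrt (\<lambda>e e'. snd e \<ge> snd e') (take n L)"
    using L' unfolding sorted_list_def sorted_wrt_append by blast
  have low: "snd (last (take n L)) \<le> snd e" if "e \<in> set (take n L)" for e
  proof -
    have "sorted_wrt (\<lambda>e e'. snd e \<ge> snd e') (butlast (take n L) @ [last (take n L)])"
      using s ne by simp
    moreover have "e \<in> set (butlast (take n L) @ [last (take n L)])" using that ne by simp
    ultimately show ?thesis unfolding sorted_wrt_append by auto
  qed
  have z: "sorted_wrt (\<lambda>e e'. snd e \<ge> snd e') (map (\<lambda>X. (X, 0 :: real)) xs)" for xs :: "'a list"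
    by (induction xs) auto
  show "sorted_list S (completion n R L)"
    unfolding sorted_list_def
  proof (intro conjI)
    show "distinct (map fst (completion n R L))"
      using d R by (auto simp: completion_def distinct_map inj_on_def comp_def filter_map)
    show "fst ` set (completion n R L) = S"
    proof -
      have "fst ` set (completion n R L) = fst ` set (take n L) \<union>
        (if R \<in> fst ` set (take n L) then {} else {R}) \<union> {X \<in> fst ` set (drop n L). X \<noteq> R}"
        by (simp add: completion_def image_Un image_image Un_assoc)
      then show ?thesis using R unfolding S by (auto split: if_splits simp del: image_iff)
    qed
    show "snd ` set (completion n R L) \<subseteq> {0..1}"
    proof safe
      fix X x assume "(X, x) \<in> set (completion n R L)"
      then show "snd (X, x) \<in> {0..1}"
        using v [of "(X, x)"] b(1,2) by (auto simp: completion_def split: if_splits)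
    qed
    show "sorted_wrt (\<lambda>e e'. snd e \<ge> snd e') (completion n R L)"
      using s z low b(1) v by (auto simp: completion_def sorted_wrt_append)
  qed
  show "take n (completion n R L) = take n L"
  proof (cases "n \<le> length L")
    case False
    then have "R \<in> fst ` set (take n L)" using R L by (simp add: sorted_list_def)
    with False show ?thesis by (simp add: completion_def)
  qed (simp add: completion_def)
  show "the (map_of (completion n R L) R) =
      (case map_of (take n L) R of Some x \<Rightarrow> x | None \<Rightarrow> snd (last (take n L)))"
  proof (cases "map_of (take n L) R")
    case None
    then have "R \<notin> fst ` set (take n L)" by (simp only: map_of_eq_None_iff not_False_eq_True)
    with None show ?thesis by (simp add: completion_def map_add_def)
  next
    case (Some x)
    then show ?thesis by (auto simp: completion_def map_add_def)
  qed
  assume Q: "Q \<in> S" "Q \<noteq> R"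
  show "the (map_of (completion n R L) Q) = (case map_of (take n L) Q of Some x \<Rightarrow> x | None \<Rightarrow> 0)"
  proof (cases "map_of (take n L) Q")
    case None
    then have "Q \<in> set (filter (\<lambda>X. X \<noteq> R) (map fst (drop n L)))"
      using Q unfolding S by (auto simp: map_of_eq_None_iff)
    then have "map_of (map (\<lambda>X. (X, 0::real)) (filter (\<lambda>X. X \<noteq> R) (map fst (drop n L)))) Q = Some 0"
      by (simp add: map_of_map_restrict restrict_map_def)
    with None Q show ?thesis by (simp add: completion_def map_add_def)
  next
    case (Some x)
    then show ?thesis by (auto simp: completion_def map_add_def)
  qed
qed

section \<open>Top sets, and stopping at the first certificate\<close>

lemma ex_top_set:
  fixes g :: "'a \<Rightarrow> real"
  assumes "finite S" "k \<le> card S"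
  shows "\<exists>Y\<subseteq>S. card Y = k \<and> (\<forall>R\<in>Y. \<forall>Q\<in>S - Y. g Q \<le> g R)"
  using assms(2)
proof (induction k)
  case (Suc k)
  then obtain Y where Y: "Y \<subseteq> S" "card Y = k" "\<forall>R\<in>Y. \<forall>Q\<in>S - Y. g Q \<le> g R" by auto
  have fY: "finite Y" using Y(1) assms(1) finite_subset by blast
  have ne: "S - Y \<noteq> {}" using Suc.prems Y assms(1)
    by (metis Diff_eq_empty_iff card_mono fY not_less_eq_eq)
  have fin: "finite (g ` (S - Y))" using assms(1) by simp
  then have "Max (g ` (S - Y)) \<in> g ` (S - Y)" using ne by (intro Max_in) auto
  then obtain R where R: "R \<in> S - Y" "g R = Max (g ` (S - Y))" by auto
  then have "g Q \<le> g R" if "Q \<in> S - Y" for Q using fin that by simp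
  with R Y fY show ?case by (intro exI [of _ "insert R Y"]) auto
qed (auto intro: exI [of _ "{}"])

lemma ex_is_top: "D \<in> databases m k \<Longrightarrow> \<exists>Y. is_top k t D Y"
  using ex_top_set [of "objects D" k "overall_grade t D"] databasesD unfolding is_top_def by metis

text \<open>Once all lists are exhausted, \<open>D\<close> is the only database of its size that
  fits \<open>h\<close>.\<close>

lemma certifies_full:
  assumes D: "D \<in> databases m k" "consistent D h" "is_top k t D Y"
    and h: "\<And>i. i < m \<Longrightarrow> card (objects D) \<le> accesses h i"
  shows "certifies m k t (card (objects D)) h Y"
  unfolding certifies_def
proof (intro ballI impI, elim conjE)
  fix D' assume D': "D' \<in> databases m k" "card (objects D') = card (objects D)" "consistent D' h"
  have "D' = D"
  proof (rule nth_equalityI)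
    show "length D' = length D" using D(1) D'(1) by (simp add: databasesD)
    fix i assume "i < length D'"
    then have i: "i < m" using D' by (simp add: databasesD)
    have "entries h i = D ! i" "entries h i = D' ! i"
      using entries_consistent [OF D(2), of i] entries_consistent [OF D'(3), of i] h [OF i] i D' D(1)
        length_sorted_list [OF databasesD(4) [OF D(1) i]] length_sorted_list [OF databasesD(4) [OF D'(1) i]]
      by (simp_all add: databasesD)
    then show "D' ! i = D ! i" by simp
  qed
  with D show "is_top k t D' Y" by simp
qed

text \<open>Algorithms are arbitrary functions of the history, so the test need not be computable.
  The schedule \<open>f\<close> may embody a lucky guess about the database: only certified sets are
  output.\<close>

definition certifying_algorithm ::
  "nat \<Rightarrow> nat \<Rightarrow> (real list \<Rightarrow> real) \<Rightarrow> (nat \<Rightarrow> nat) \<Rightarrow> 'a algorithm" where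
  "certifying_algorithm m k t f = (\<lambda>N h. return_pmf
     (if \<exists>Y. certifies m k t N h Y then Output (SOME Y. certifies m k t N h Y)
      else Access (f (length h))))"

text \<open>The hypothesis makes \<open>f\<close> visit every list as often as desired, so a
  certificate exists at the latest when all lists are exhausted.\<close>

lemma certifying_algorithm_correct:
  assumes "\<And>N. \<exists>n. \<forall>i<m. N \<le> card {j. j < n \<and> f j = i}"
  shows "certifying_algorithm m k t f \<in> correct_algorithms m k t"
  unfolding correct_algorithms_def mem_Collect_eq
proof (intro ballI conjI)
  fix D :: "'a database" assume D: "D \<in> databases m k"
  let ?N = "card (objects D)"
  let ?stop = "\<lambda>h :: 'a history. \<exists>Y. certifies m k t ?N h Y"
  let ?l = "LEAST n. ?stop (static_history D f n)"
  obtain n where n: "\<forall>i<m. ?N \<le> card {j. j < n \<and> f j = i}" using assms by blast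
  obtain Y where "is_top k t D Y" using ex_is_top D by blast
  then have "certifies m k t ?N (static_history D f n) Y"
    by (rule certifies_full [OF D consistent_static_history]) (simp add: n accesses_static_history)
  then have stop: "?stop (static_history D f n)" by blast
  have run: "run (certifying_algorithm m k t f) D [] =
     (let h = static_history D f ?l in return_spmf (h, SOME Y. certifies m k t ?N h Y))"
    by (rule run_static [where stop = ?stop]) (use stop in \<open>auto simp: certifying_algorithm_def\<close>)
  then show "lossless_spmf (run (certifying_algorithm m k t f) D [])" by (simp add: Let_def)
  have "?stop (static_history D f ?l)" by (rule LeastI) (rule stop)
  then have "certifies m k t ?N (static_history D f ?l) (SOME Y. certifies m k t ?N (static_history D f ?l) Y)"
    by (rule someI_ex)
  then have "is_top k t D (SOME Y. certifies m k t ?N (static_history D f ?l) Y)"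
    using D consistent_static_history unfolding certifies_def by blast
  then show "case x of (h, Y) \<Rightarrow> is_top k t D Y"
    if "x \<in> set_spmf (run (certifying_algorithm m k t f) D [])" for x
    using that by (simp add: run Let_def)
qed

lemma certifying_algorithm_cost:
  assumes "certifies m k t (card (objects D)) (static_history D f n) Y" "0 \<le> cS"
  shows "cost cS (certifying_algorithm m k t f) D \<le> ennreal (n * cS)"
  by (rule cost_static [where stop = "\<lambda>h. \<exists>Y. certifies m k t (card (objects D)) h Y"])
    (use assms in \<open>auto simp: certifying_algorithm_def\<close>)

lemma card_mod_eq:
  assumes "i < (m :: nat)"
  shows "card {j. j < m * d \<and> j mod m = i} = d"
proof (induction d)
  case (Suc d)
  have "{j. j < m * Suc d \<and> j mod m = i} = insert (m * d + i) {j. j < m * d \<and> j mod m = i}"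
    (is "?A = ?B")
  proof (intro set_eqI iffI)
    fix j assume "j \<in> ?A"
    then have j: "j < m * Suc d" "j mod m = i" by auto
    show "j \<in> ?B"
    proof (cases "j < m * d")
      case False
      have "m * (j div m) + i = j" using j(2) by (metis mult_div_mod_eq)
      moreover have "j div m = d"
        using False j(1) assms by (metis div_less_iff_less_mult less_Suc_eq mult.commute not_less_zero gr0I)
      ultimately show ?thesis by simp
    qed (use j in simp)
  qed (use assms in auto)
  then show ?case using Suc by simp
qed simp

section \<open>Optimality of NRA\<close>

lemma monotone_aggregation_map:
  assumes "monotone_aggregation m t"
    and "\<And>i. i < m \<Longrightarrow> 0 \<le> f i \<and> f i \<le> g i \<and> g i \<le> 1"
  shows "t (map f [0..<m]) \<le> t (map g [0..<m])"
proof -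
  have "map f [0..<m] \<in> grade_tuples m" "map g [0..<m] \<in> grade_tuples m"
    using assms(2) by (fastforce simp: grade_tuples_def)+
  with assms show ?thesis unfolding monotone_aggregation_def by simp
qed

lemma entries_database:
  "D \<in> databases m k \<Longrightarrow> consistent D h \<Longrightarrow> i < m \<Longrightarrow> entries h i = take (accesses h i) (D ! i)"
  by (simp add: entries_consistent databasesD)

lemma seen_subset_objects:
  assumes "D \<in> databases m k" "consistent D h"
  shows "seen h \<subseteq> objects D"
proof
  fix R assume "R \<in> seen h"
  then obtain i where "i < m" "R \<in> fst ` set (take (accesses h i) (D ! i))"
    using assms by (auto simp: seen_consistent databasesD simp del: image_iff)
  with databasesD(4) [OF assms(1), of i] show "R \<in> objects D"
    by (auto simp: sorted_list_def dest: in_set_takeD)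
qed

lemma W_le_overall_grade:
  assumes D: "D \<in> databases m k" "consistent D h" and "monotone_aggregation m t" and R: "R \<in> objects D"
  shows "W_bound m t h R \<le> overall_grade t D R"
  unfolding W_bound_def overall_grade_nth [OF databasesD(1) [OF D(1)]]
proof (rule monotone_aggregation_map [OF assms(3)])
  fix i assume i: "i < m"
  obtain x where x: "map_of (D ! i) R = Some x" "0 \<le> x" "x \<le> 1"
    using sorted_list_value [OF databasesD(4) [OF D(1) i] R] .
  have "y = x" if "map_of (entries h i) R = Some y" for y
    using that x(1) map_of_take by (fastforce simp: entries_database [OF D i])
  with x show "0 \<le> (case map_of (entries h i) R of None \<Rightarrow> 0 | Some x \<Rightarrow> x) \<and>
    (case map_of (entries h i) R of None \<Rightarrow> 0 | Some x \<Rightarrow> x) \<le> the (map_of (D ! i) R) \<and>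
    the (map_of (D ! i) R) \<le> 1"
    by (cases "map_of (entries h i) R") auto
qed

text \<open>A missing field is at most the bottom value of its list. Each list must have been
  accessed, since \<open>bottom\<close> is unspecified when no entry was read.\<close>

lemma overall_grade_le_B:
  assumes D: "D \<in> databases m k" "consistent D h" and "monotone_aggregation m t" and R: "R \<in> objects D"
    and h: "\<And>i. i < m \<Longrightarrow> 0 < accesses h i"
  shows "overall_grade t D R \<le> B_bound m t h R"
  unfolding B_bound_def overall_grade_nth [OF databasesD(1) [OF D(1)]]
proof (rule monotone_aggregation_map [OF assms(3)])
  fix i assume i: "i < m"
  obtain x where x: "map_of (D ! i) R = Some x" "0 \<le> x" "x \<le> 1"
    using sorted_list_value [OF databasesD(4) [OF D(1) i] R] .
  have "y = x" if "map_of (entries h i) R = Some y" for y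
    using that x(1) map_of_take by (fastforce simp: entries_database [OF D i])
  with x show "0 \<le> the (map_of (D ! i) R) \<and> the (map_of (D ! i) R) \<le>
    (case map_of (entries h i) R of None \<Rightarrow> bottom h i | Some x \<Rightarrow> x) \<and>
    (case map_of (entries h i) R of None \<Rightarrow> bottom h i | Some x \<Rightarrow> x) \<le> 1"
    using sorted_list_bottom [OF databasesD(4) [OF D(1) i] R h [OF i]]
    by (cases "map_of (entries h i) R") (auto simp: bottom_def entries_database [OF D i])
qed

lemma B_bound_unseen:
  assumes "R \<notin> seen h"
  shows "B_bound m t h R = t (map (bottom h) [0..<m])"
proof -
  have "map_of (entries h i) R = None" for i
    using assms unfolding map_of_eq_None_iff seen_def image_iff Bex_def in_set_entries_iff
    by (metis (mono_tags, lifting) mem_Collect_eq prod.collapse)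
  then show ?thesis by (simp add: B_bound_def cong: map_cong)
qed

text \<open>All unseen objects share one value of \<open>B\<close>, so the separate clause for them
  merges with the clause for seen objects.\<close>

lemma NRA_halts_iff:
  assumes D: "D \<in> databases m k" "consistent D h" and T: "is_T m k t h T"
  shows "NRA_halts m k t (card (objects D)) h T \<longleftrightarrow> k \<le> card (seen h) \<and>
    (\<forall>R\<in>objects D - T. B_bound m t h R \<le> Min (W_bound m t h ` T))"
proof -
  have s: "seen h \<subseteq> objects D" using seen_subset_objects D by blast
  have ex: "card (seen h) < card (objects D) \<longleftrightarrow> (\<exists>R. R \<in> objects D - seen h)"
  proof
    assume "card (seen h) < card (objects D)"
    then have "seen h \<noteq> objects D" by auto
    with s show "\<exists>R. R \<in> objects D - seen h" by blast
  next
    assume "\<exists>R. R \<in> objects D - seen h"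
    with s have "seen h \<subset> objects D" by blast
    then show "card (seen h) < card (objects D)"
      by (rule psubset_card_mono [OF databasesD(3) [OF D(1)]])
  qed
  have "B_bound m t h R = t (map (bottom h) [0..<m])" if "R \<in> objects D - seen h" for R
    using that by (intro B_bound_unseen) simp
  then have unseen: "(\<forall>R\<in>objects D - seen h. B_bound m t h R \<le> M) \<longleftrightarrow>
      (card (seen h) < card (objects D) \<longrightarrow> t (map (bottom h) [0..<m]) \<le> M)" for M
    unfolding ex by auto
  have "T \<subseteq> seen h" using T unfolding is_T_def by (rule conjunct1)
  with s have eq: "objects D - T = (seen h - T) \<union> (objects D - seen h)" by blast
  show ?thesis
    unfolding NRA_halts_def Let_def eq ball_Un unseen by (rule refl)
qed

lemma is_T_finite:
  assumes "is_T m k t h T" "1 \<le> k"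
  shows "finite T" "T \<noteq> {}"
proof -
  have "0 < card T" using assms unfolding is_T_def by linarith
  then show "finite T" "T \<noteq> {}" by (auto intro: card_ge_0_finite)
qed

text \<open>Grades outside \<open>T\<close> are at most \<open>B\<close>, hence at most the least
  \<open>W\<close> in \<open>T\<close>, hence at most every grade inside \<open>T\<close>.\<close>

lemma NRA_halts_is_top:
  assumes D: "D \<in> databases m k" "consistent D h" and t: "monotone_aggregation m t"
    and h: "\<And>i. i < m \<Longrightarrow> 0 < accesses h i" and T: "is_T m k t h T" "1 \<le> k"
    and halts: "NRA_halts m k t (card (objects D)) h T"
  shows "is_top k t D T"
  unfolding is_top_def
proof (intro conjI ballI)
  show "T \<subseteq> objects D" "card T = k"
    using T seen_subset_objects [OF D] by (auto simp: is_T_def)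
  fix R Q assume R: "R \<in> T" and Q: "Q \<in> objects D - T"
  have "overall_grade t D Q \<le> B_bound m t h Q"
    using overall_grade_le_B [OF D t _ h] Q by blast
  also have "\<dots> \<le> Min (W_bound m t h ` T)"
    using halts Q unfolding NRA_halts_iff [OF D T(1)] by blast
  also have "\<dots> \<le> W_bound m t h R" using R is_T_finite [OF T] by simp
  also have "\<dots> \<le> overall_grade t D R"
    using W_le_overall_grade [OF D t] R \<open>T \<subseteq> objects D\<close> by blast
  finally show "overall_grade t D Q \<le> overall_grade t D R" .
qed

section \<open>Certificates force NRA to halt\<close>

text \<open>Renaming an unseen object is invisible to the algorithm.\<close>

lemma certifies_seen:
  fixes D :: "'a database"
  assumes inf: "infinite (UNIV :: 'a set)" and D: "D \<in> databases m k" "consistent D h" and "1 \<le> m"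
    and Y: "certifies m k t (card (objects D)) h Y"
  shows "Y \<subseteq> seen h"
proof (rule ccontr)
  assume "\<not> Y \<subseteq> seen h"
  then obtain y where y: "y \<in> Y" "y \<notin> seen h" by blast
  have "is_top k t D Y" using Y D by (simp add: certifies_def)
  then have yD: "y \<in> objects D" using y by (auto simp: is_top_def)
  \<comment> \<open>A fresh name exists because the object type is infinite while \<open>D\<close>
    is finite.\<close>
  obtain z where z: "z \<notin> objects D" using ex_new_if_finite [OF inf databasesD(3) [OF D(1)]] by blast
  define s where "s = (\<lambda>R. if R = y then z else R)"
  let ?S = "s ` objects D"
  have inj: "inj_on s (objects D)" using z by (auto simp: s_def inj_on_def)
  define D' where "D' = map (\<lambda>i. map (map_prod s id) (D ! i)) [0..<m]"
  have sl: "sorted_list ?S (D' ! i)" if i: "i < m" for i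
  proof -
    note L = databasesD(4) [OF D(1) i, unfolded sorted_list_def]
    have eq: "D' ! i = map (map_prod s id) (D ! i)" using i by (simp add: D'_def)
    have "map fst (D' ! i) = map s (map fst (D ! i))" by (simp add: eq)
    moreover have "distinct (map s (map fst (D ! i)))"
      using L inj by (subst distinct_map) auto
    moreover have "fst ` set (D' ! i) = s ` fst ` set (D ! i)" "snd ` set (D' ! i) = snd ` set (D ! i)"
      by (simp_all add: eq image_image)
    moreover have "sorted_wrt (\<lambda>e e'. snd e \<ge> snd e') (D' ! i)"
      using L by (simp add: eq sorted_wrt_map)
    ultimately show ?thesis using L by (simp only: sorted_list_def)
  qed
  have card: "card ?S = card (objects D)" using inj by (rule card_image)
  have "length D' = m" "0 < m" "k \<le> card ?S"
    using databasesD(2) [OF D(1)] \<open>1 \<le> m\<close> card by (auto simp: D'_def)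
  note D' = databasesI [OF this sl]
  have "consistent D' h"
  proof (rule consistent_agree [OF D(2)])
    show "length D' = length D" using D by (simp add: D'_def databasesD)
    fix i assume "i < length D"
    then have i: "i < m" using D by (simp add: databasesD)
    have "map_prod s id e = e" if "e \<in> set (take (accesses h i) (D ! i))" for e
    proof -
      have "fst e \<in> seen h" using that i D by (auto simp: seen_consistent databasesD)
      then show ?thesis using y by (cases e) (auto simp: s_def)
    qed
    then show "take (accesses h i) (D' ! i) = take (accesses h i) (D ! i)"
      using i by (simp add: D'_def take_map map_idI)
  qed
  then have "is_top k t D' Y" using Y D' card by (simp add: certifies_def)
  then have "y \<in> ?S" using y D' by (auto simp: is_top_def)
  with z yD show False by (auto simp: s_def split: if_splits)
qed

text \<open>Completing every list in favour of \<open>R\<close> gives a database that still fits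
  \<open>h\<close>; there \<open>R\<close> attains its \<open>B\<close> and \<open>Q\<close> falls
  to its \<open>W\<close>. As \<open>Y\<close> is a top set there too, the bounds compare.\<close>

lemma certifies_W_ge_B:
  assumes D: "D \<in> databases m k" "consistent D h" and m: "1 \<le> m"
    and h: "\<And>i. i < m \<Longrightarrow> 0 < accesses h i"
    and Y: "certifies m k t (card (objects D)) h Y"
    and Q: "Q \<in> Y" and R: "R \<in> objects D" "R \<notin> Y"
  shows "B_bound m t h R \<le> W_bound m t h Q"
proof -
  define D' where "D' = map (\<lambda>i. completion (accesses h i) R (D ! i)) [0..<m]"
  have D'_nth: "D' ! i = completion (accesses h i) R (D ! i)" if "i < m" for i
    using that by (simp add: D'_def)
  note sl = databasesD(4) [OF D(1)]
  have "sorted_list (objects D) (D' ! i)" if "i < m" for i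
    using sorted_list_completion [OF sl [OF that] R(1) h [OF that]] that by (simp add: D'_def)
  then have D': "D' \<in> databases m k" "objects D' = objects D"
    using databasesI [of D' m k "objects D"] databasesD(2) [OF D(1)] m by (auto simp: D'_def)
  have len: "length D = m" "length D' = m" using D by (auto simp: D'_def databasesD)
  have "consistent D' h"
    using len by (intro consistent_agree [OF D(2)]) (simp_all add: D'_nth take_completion [OF sl R(1) h])
  then have top: "is_top k t D' Y" using Y D' by (simp add: certifies_def)
  then have QD: "Q \<in> objects D" "Q \<noteq> R" using Q R D' by (auto simp: is_top_def)
  have "overall_grade t D' R = B_bound m t h R"
    unfolding B_bound_def overall_grade_nth [OF len(2)] bottom_def
    by (intro arg_cong [of _ _ t] map_cong)
      (simp_all add: D'_nth completion_target [OF sl R(1) h] entries_database [OF D] split: option.split)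
  moreover have "overall_grade t D' Q = W_bound m t h Q"
    unfolding W_bound_def overall_grade_nth [OF len(2)]
    by (intro arg_cong [of _ _ t] map_cong)
      (simp_all add: D'_nth completion_other [OF sl R(1) h QD] entries_database [OF D])
  moreover have "overall_grade t D' R \<le> overall_grade t D' Q"
    using top Q R D' by (simp add: is_top_def)
  ultimately show ?thesis by simp
qed

text \<open>The set \<open>?T\<close> kept by NRA may differ from the certified \<open>Y\<close>.
  The argument uses that both have \<open>k\<close> elements and that \<open>?T\<close> prefers
  larger \<open>W\<close>, then larger \<open>B\<close>.\<close>

lemma certifies_imp_NRA_halts:
  fixes D :: "'a database"
  assumes inf: "infinite (UNIV :: 'a set)" and D: "D \<in> databases m k" "consistent D h"
    and m: "1 \<le> m" "1 \<le> k" and t: "monotone_aggregation m t"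
    and h: "\<And>i. i < m \<Longrightarrow> 0 < accesses h i"
    and T: "T_rule m k t T"
    and Y: "certifies m k t (card (objects D)) h Y"
  shows "NRA_halts m k t (card (objects D)) h (T (card (objects D)) h)"
proof -
  let ?T = "T (card (objects D)) h" and ?W = "W_bound m t h" and ?B = "B_bound m t h"
  have s: "seen h \<subseteq> objects D" using seen_subset_objects D by blast
  have fs: "finite (seen h)" using s databasesD(3) [OF D(1)] finite_subset by blast
  have Ys: "Y \<subseteq> seen h" by (rule certifies_seen [OF inf D m(1) Y])
  have "is_top k t D Y" using Y D by (simp add: certifies_def)
  then have cY: "card Y = k" by (simp add: is_top_def)
  then have ks: "k \<le> card (seen h)" using Ys fs card_mono by blast
  then have is_T: "is_T m k t h ?T" using T by (simp add: T_rule_def)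
  then have Ts: "?T \<subseteq> seen h" and cT: "card ?T = k"
    unfolding is_T_def by blast+
  have better: "?W Q < ?W R \<or> ?W Q = ?W R \<and> ?B Q \<le> ?B R" if "R \<in> ?T" "Q \<in> seen h - ?T" for R Q
    using that is_T unfolding is_T_def by blast
  note fin = is_T_finite [OF is_T m(2)]
  have fY: "finite Y" using Ys fs finite_subset by blast
  have WB: "?B R \<le> ?W Q" if "Q \<in> Y" "R \<in> objects D" "R \<notin> Y" for Q R
    using certifies_W_ge_B [OF D m(1) h Y that] .
  have "?B R \<le> Min (?W ` ?T)" if R: "R \<in> objects D - ?T" for R
  proof (cases "R \<in> Y")
    case False
    \<comment> \<open>If \<open>Y = ?T\<close>, the minimiser serves as \<open>Q\<close>; otherwise
      any member of \<open>Y\<close> outside \<open>?T\<close> does.\<close>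
    have "\<exists>Q\<in>Y. ?W Q \<le> Min (?W ` ?T)"
    proof (cases "Y \<subseteq> ?T")
      case True
      then have "Y = ?T" using fin cY cT card_subset_eq by metis
      moreover have "Min (?W ` ?T) \<in> ?W ` ?T" using fin by (intro Min_in) auto
      ultimately show ?thesis by force
    next
      case False
      then obtain Q where Q: "Q \<in> Y" "Q \<in> seen h - ?T" using Ys by blast
      then have "?W Q \<le> ?W X" if "X \<in> ?T" for X using better [OF that Q(2)] by auto
      with Q fin show ?thesis by auto
    qed
    with WB False R show ?thesis by fastforce
  next
    case True
    then have Rs: "R \<in> seen h - ?T" using R Ys by blast
    \<comment> \<open>Here the tie-breaking rule is decisive. Some \<open>X\<close> in
      \<open>?T\<close> lies outside \<open>Y\<close>, and \<open>?W X \<le> ?B X \<le> ?W R\<close>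
      excludes a strict preference for \<open>X\<close>. So the two tie in \<open>W\<close>, and the
      rule gives \<open>?B R \<le> ?B X \<le> ?W R\<close>.\<close>
    have "\<not> ?T \<subseteq> Y" using True R fY cY cT card_subset_eq by (metis Diff_iff)
    then obtain X where X: "X \<in> ?T" "X \<notin> Y" by blast
    have XD: "X \<in> objects D" using X Ts s by blast
    have "?W X \<le> ?B X"
      using W_le_overall_grade [OF D t XD] overall_grade_le_B [OF D t XD h] by (rule order_trans)
    moreover have "?B X \<le> ?W R" using WB [OF True XD X(2)] .
    ultimately have "?B R \<le> ?W R" using better [OF X(1) Rs] by auto
    moreover have "?W R \<le> ?W Z" if "Z \<in> ?T" for Z using better [OF that Rs] by auto
    ultimately show ?thesis using fin by (auto intro: order_trans)
  qed
  with ks show ?thesis by (simp add: NRA_halts_iff [OF D is_T])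
qed

text \<open>Round-robin access to depth \<open>d\<close> reads every list at least as far as
  \<open>h\<close>, so the certificate carries over; \<open>1 \<le> d\<close> makes the bottom
  values meaningful.\<close>

lemma NRA_stops:
  fixes D :: "'a database" and m k t T
  defines "H n \<equiv> static_history D (\<lambda>n. n mod m) n" and "N \<equiv> card (objects D)"
  defines "stop h \<equiv> m dvd length h \<and> NRA_halts m k t N h (T N h)"
  assumes inf: "infinite (UNIV :: 'a set)" and D: "D \<in> databases m k" "consistent D h"
    and m: "1 \<le> m" "1 \<le> k" and t: "monotone_aggregation m t" and T: "T_rule m k t T"
    and Y: "certifies m k t N h Y"
    and d: "1 \<le> d" "\<And>i. i < m \<Longrightarrow> accesses h i \<le> d"
  shows "stop (H (m * d))"
proof -
  have a: "accesses (H (m * d)) i = d" if "i < m" for i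
    using that by (simp add: H_def accesses_static_history card_mod_eq)
  have c: "consistent D (H (m * d))" by (simp add: H_def consistent_static_history)
  have "certifies m k t N (H (m * d)) Y"
    by (rule certifies_mono [OF Y D c]) (simp add: a d)
  then have "NRA_halts m k t N (H (m * d)) (T N (H (m * d)))"
    unfolding N_def using a d by (intro certifies_imp_NRA_halts [OF inf D(1) c m t _ T]) auto
  then show ?thesis by (simp add: stop_def H_def)
qed

lemma NRA_instance_optimal:
  fixes T :: "nat \<Rightarrow> 'a history \<Rightarrow> 'a set"
  assumes inf: "infinite (UNIV :: 'a set)" and m: "1 \<le> m" "1 \<le> k" and "0 < cS"
    and t: "monotone_aggregation m t" and T: "T_rule m k t T"
  shows "instance_optimal (cost cS) (correct_algorithms m k t) (databases m k) (real m) (NRA m k t T)"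
  unfolding instance_optimal_def
proof (intro conjI exI ballI)
  let ?stop = "\<lambda>N h. m dvd length h \<and> NRA_halts m k t N h (T N h)"
  let ?H = "\<lambda>D. static_history D (\<lambda>n. n mod m)"
  show "NRA m k t T \<in> correct_algorithms m k t"
    unfolding correct_algorithms_def mem_Collect_eq
  proof (intro ballI conjI)
    fix D :: "'a database" assume D: "D \<in> databases m k"
    let ?N = "card (objects D)"
    let ?l = "LEAST n. ?stop ?N (?H D n)"
    obtain Y where Y: "is_top k t D Y" using ex_is_top D by blast
    have "1 \<le> ?N" using databasesD(2) [OF D] m by simp
    have c: "certifies m k t ?N (?H D (m * ?N)) Y"
      by (rule certifies_full [OF D consistent_static_history Y]) (simp add: accesses_static_history card_mod_eq)
    have stop: "?stop ?N (?H D (m * ?N))"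
      by (rule NRA_stops [OF inf D _ m t T c \<open>1 \<le> ?N\<close>])
        (simp_all add: consistent_static_history accesses_static_history card_mod_eq)
    have run: "run (NRA m k t T) D [] = (let h = ?H D ?l in return_spmf (h, T ?N h))"
      by (rule run_static [where stop = "?stop ?N", OF _ stop]) (auto simp: NRA_def)
    then show "lossless_spmf (run (NRA m k t T) D [])" by (simp add: Let_def)
    have l: "?stop ?N (?H D ?l)" by (rule LeastI) (rule stop)
    then obtain d where d: "?l = m * d" by auto
    have a: "accesses (?H D ?l) i = d" if "i < m" for i
      unfolding d accesses_static_history by (rule card_mod_eq [OF that])
    have ks: "k \<le> card (seen (?H D ?l))" using l by (simp add: NRA_halts_def)
    \<comment> \<open>At depth \<open>0\<close> nothing has been seen, whereas halting requires
      \<open>k\<close> seen objects.\<close>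
    have "0 < d"
    proof (rule ccontr)
      assume "\<not> 0 < d"
      then have "?H D ?l = []" unfolding d by simp
      with ks m show False by (simp add: seen_def)
    qed
    then have "is_top k t D (T ?N (?H D ?l))"
      using T ks l a by (intro NRA_halts_is_top [OF D consistent_static_history t _ _ m(2)])
        (auto simp: T_rule_def)
    then show "case x of (h, Y) \<Rightarrow> is_top k t D Y" if "x \<in> set_spmf (run (NRA m k t T) D [])" for x
      using that by (simp add: run Let_def)
  qed
  fix A :: "'a algorithm" and D :: "'a database"
  assume A: "A \<in> correct_algorithms m k t" and D: "D \<in> databases m k"
  let ?N = "card (objects D)" and ?C = "cost cS (NRA m k t T) D"
  have lossless: "lossless_spmf (run A D [])" using A D by (simp add: correct_algorithms_def)
  \<comment> \<open>\<open>A\<close> reads no list more than \<open>length h\<close> times. The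
    extra \<open>1\<close> secures a positive depth and is the source of the additive constant
    \<open>m * cS\<close>.\<close>
  have le: "?C \<le> ennreal (m * (length h + 1) * cS)" if r: "(h, Y) \<in> set_spmf (run A D [])" for h Y
  proof -
    have c: "consistent D h" using r by (simp add: set_run_iff)
    have "?stop ?N (?H D (m * (length h + 1)))"
      by (rule NRA_stops [OF inf D c m t T run_certifies [OF A D r]])
        (auto intro: le_SucI accesses_le_length)
    then show ?thesis
      using \<open>0 < cS\<close> by (intro cost_static [where stop = "?stop ?N"]) (auto simp: NRA_def)
  qed
  \<comment> \<open>A single outcome of \<open>A\<close> shows that the cost of NRA is finite, hence
    a real number as \<open>cost_ge\<close> requires.\<close>
  obtain h0 Y0 where "(h0, Y0) \<in> set_spmf (run A D [])"
    using lossless_support [OF lossless] by auto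
  from le [OF this] have fin: "?C < \<top>" using ennreal_less_top order_le_less_trans by blast
  have "ennreal (enn2real ?C) \<le> ennreal m * cost cS A D + ennreal (m * cS)"
  proof (rule cost_ge [OF lossless])
    fix h Y assume "(h, Y) \<in> set_spmf (run A D [])"
    from le [OF this] have "enn2real ?C \<le> m * (length h + 1) * cS"
      using \<open>0 < cS\<close> by (simp add: enn2real_leI)
    then show "enn2real ?C \<le> m * (length h * cS) + m * cS" by (simp add: algebra_simps)
  qed (use \<open>0 < cS\<close> in auto)
  with fin show "?C \<le> ennreal m * cost cS A D + ennreal (m * cS)" by simp
qed

section \<open>The lower bound for deterministic algorithms\<close>

lemma aggregation_le_one:
  assumes "monotone_aggregation m t" "strict_aggregation m t" and xs: "xs \<in> grade_tuples m"
  shows "t xs \<le> 1"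
proof -
  have r: "replicate m 1 \<in> grade_tuples m" by (auto simp: grade_tuples_def)
  then have "t (replicate m 1) = 1" using assms(2) by (simp add: strict_aggregation_def)
  moreover have "\<forall>i<m. xs ! i \<le> replicate m 1 ! i"
  proof (intro allI impI)
    fix i assume "i < m"
    then have "xs ! i \<in> set xs" "xs ! i \<in> {0..1}"
      using xs by (auto simp: grade_tuples_def subset_iff)
    with \<open>i < m\<close> show "xs ! i \<le> replicate m 1 ! i" by simp
  qed
  ultimately show ?thesis using assms(1) xs r by (metis monotone_aggregation_def)
qed

definition full_grade :: "'a database \<Rightarrow> 'a \<Rightarrow> bool" where
  "full_grade D R \<longleftrightarrow> (\<forall>i<length D. map_of (D ! i) R = Some 1)"

text \<open>Monotonicity caps all grades at that of the all-ones tuple; by strictness this cap is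
  \<open>1\<close> and no other tuple attains it.\<close>

lemma overall_grade_strict:
  assumes t: "monotone_aggregation m t" "strict_aggregation m t"
    and D: "D \<in> databases m k" and R: "R \<in> objects D"
  shows "overall_grade t D R \<le> 1" "overall_grade t D R = 1 \<longleftrightarrow> full_grade D R"
proof -
  let ?xs = "map (\<lambda>i. the (map_of (D ! i) R)) [0..<m]"
  have v: "\<exists>x. map_of (D ! i) R = Some x \<and> 0 \<le> x \<and> x \<le> 1" if "i < m" for i
    using sorted_list_value [OF databasesD(4) [OF D that] R] by metis
  then have xs: "?xs \<in> grade_tuples m" by (fastforce simp: grade_tuples_def)
  note o = overall_grade_nth [OF databasesD(1) [OF D], of t R]
  show "overall_grade t D R \<le> 1" unfolding o by (rule aggregation_le_one [OF t xs])
  have "t ?xs = 1 \<longleftrightarrow> (\<forall>i<m. ?xs ! i = 1)" using t(2) xs unfolding strict_aggregation_def by blast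
  also have "\<dots> \<longleftrightarrow> full_grade D R"
    using v by (fastforce simp: full_grade_def databasesD(1) [OF D])
  finally show "overall_grade t D R = 1 \<longleftrightarrow> full_grade D R" unfolding o .
qed

text \<open>If \<open>Y\<close> omitted a full-grade object, it would contain one of grade below
  \<open>1\<close>. Uniqueness of the top set lets answers tell databases apart.\<close>

lemma is_top_eq_full_grade:
  assumes t: "monotone_aggregation m t" "strict_aggregation m t"
    and D: "D \<in> databases m k" and Y: "is_top k t D Y"
    and Z: "Z = {R \<in> objects D. full_grade D R}" "card Z = k"
  shows "Y = Z"
proof -
  note g = overall_grade_strict [OF t D]
  have Yo: "Y \<subseteq> objects D" "card Y = k" using Y by (auto simp: is_top_def)
  have fin: "finite Y" "finite Z" using Yo Z databasesD(3) [OF D] finite_subset by auto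
  have "Z \<subseteq> Y"
  proof (rule ccontr)
    assume "\<not> Z \<subseteq> Y"
    then obtain Q where Q: "Q \<in> Z" "Q \<notin> Y" by blast
    then have "\<not> Y \<subseteq> Z" using fin Yo Z(2) card_subset_eq by metis
    then obtain R where R: "R \<in> Y" "R \<notin> Z" by blast
    have "overall_grade t D Q \<le> overall_grade t D R"
      using Y Q R Z(1) by (simp add: is_top_def)
    moreover have "overall_grade t D Q = 1" using Q Z(1) g by auto
    moreover have "overall_grade t D R \<noteq> 1" "overall_grade t D R \<le> 1" using R Yo Z(1) g by auto
    ultimately show False by simp
  qed
  then show ?thesis using fin Yo Z(2) card_subset_eq by metis
qed

text \<open>Grade \<open>1\<close> is maximal, so \<open>k\<close> objects seen with
  \<open>1\<close> in all lists are a right answer whatever remains unread.\<close>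

lemma certifies_full_grade:
  assumes t: "monotone_aggregation m t" "strict_aggregation m t"
    and D: "D \<in> databases m k" "consistent D h"
    and Z: "card Z = k" "\<And>R i. R \<in> Z \<Longrightarrow> i < m \<Longrightarrow> (R, 1) \<in> set (take (accesses h i) (D ! i))" and "1 \<le> m"
  shows "certifies m k t N h Z"
  unfolding certifies_def
proof (intro ballI impI, elim conjE)
  fix D' assume D': "D' \<in> databases m k" "card (objects D') = N" "consistent D' h"
  have mem: "(R, 1) \<in> set (D' ! i)" if "R \<in> Z" "i < m" for R i
  proof -
    have "take (accesses h i) (D' ! i) = take (accesses h i) (D ! i)"
      using entries_consistent [OF D(2), of i] entries_consistent [OF D'(3), of i] that D D'
      by (simp add: databasesD)
    with Z(2) [OF that] have "(R, 1) \<in> set (take (accesses h i) (D' ! i))" by simp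
    then show ?thesis by (rule in_set_takeD)
  qed
  have "R \<in> objects D' \<and> full_grade D' R" if R: "R \<in> Z" for R
  proof
    have "0 < m" using \<open>1 \<le> m\<close> by simp
    from mem [OF R this] databasesD(4) [OF D'(1) this] show "R \<in> objects D'"
      by (force simp: sorted_list_def)
    show "full_grade D' R"
      using mem [OF R] databasesD(1,4) [OF D'(1)] by (auto simp: full_grade_def sorted_list_def)
  qed
  then have "R \<in> objects D' \<and> overall_grade t D' R = 1" if "R \<in> Z" for R
    using that overall_grade_strict(2) [OF t D'(1)] by blast
  then show "is_top k t D' Z"
    using overall_grade_strict(1) [OF t D'(1)] Z(1) by (auto simp: is_top_def)
qed

section \<open>Runs of a deterministic algorithm\<close>

lemma deterministic_action:
  assumes "deterministic B" "a \<in> set_pmf (B N h)" "a' \<in> set_pmf (B N h)"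
  shows "a = a'"
proof -
  obtain x where "B N h = return_pmf x" using assms(1) unfolding deterministic_def by blast
  with assms(2,3) show ?thesis by simp
qed

text \<open>The history fixes the next access and the database fixes its result, so two partial runs
  on one database cannot diverge.\<close>

lemma deterministic_prefix:
  assumes "deterministic B" and h: "consistent D h" "follows B N h"
    and h': "consistent D h'" "follows B N h'" and le: "length h \<le> length h'"
  shows "take (length h) h' = h"
proof -
  have "take n h' = take n h" if "n \<le> length h" for n
    using that
  proof (induction n)
    case (Suc n)
    then have IH: "take n h' = take n h" and n: "n < length h" "n < length h'" using le by auto
    have "fst (h' ! n) = fst (h ! n)"
      using h(2) h'(2) n IH deterministic_action [OF assms(1)] unfolding follows_def
      by (metis action.inject(1))
    moreover from this have "snd (h' ! n) = snd (h ! n)"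
      using h(1) h'(1) n IH by (simp add: consistent_def)
    ultimately show ?case using n IH by (simp add: take_Suc_conv_app_nth prod_eq_iff)
  qed simp
  from this [of "length h"] show ?thesis by simp
qed

text \<open>With only the grades \<open>0\<close> and \<open>1\<close>, the hiding is done by the
  order among ties.\<close>

definition top_list :: "'a list \<Rightarrow> 'a list \<Rightarrow> ('a \<times> real) list" where
  "top_list as xs = map (\<lambda>X. (X, 1)) xs @ map (\<lambda>X. (X, 0)) (filter (\<lambda>X. X \<notin> set xs) as)"

lemma sorted_list_top_list:
  assumes "distinct as" "distinct xs" "set xs \<subseteq> set as"
  shows "sorted_list (set as) (top_list as xs)"
proof -
  have "sorted_wrt (\<lambda>e e'. snd e \<ge> snd e') (map (\<lambda>X. (X, c :: real)) ys)" for c and ys :: "'a list"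
    by (induction ys) auto
  then show ?thesis
    using assms by (auto simp: sorted_list_def top_list_def comp_def sorted_wrt_append image_Un image_image)
qed

lemma map_of_top_list: "map_of (top_list as xs) R = Some 1 \<longleftrightarrow> R \<in> set xs"
proof (cases "R \<in> set xs")
  case True
  then show ?thesis by (simp add: top_list_def map_add_def map_of_map_restrict restrict_map_def)
next
  case False
  then show ?thesis by (simp add: top_list_def map_add_def map_of_map_restrict restrict_map_def)
qed

lemma take_top_list: "n \<le> length xs \<Longrightarrow> take n (top_list as xs) = map (\<lambda>X. (X, 1)) (take n xs)"
  by (simp add: top_list_def take_map)

section \<open>Databases that hide the last winner\<close>

text \<open>Objects are coded as triples: \<open>(0, n, 0)\<close> are the \<open>k - 1\<close> sure winners, \<open>(1, i, 0)\<close> and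
  \<open>(1, i, 1)\<close> are the two candidates for the last place whose grade in list \<open>i\<close> is hidden deep in
  that list, and \<open>(2, i, n)\<close> are objects that hide it there and have grade \<open>0\<close> in the other lists.\<close>

definition front_codes :: "nat \<Rightarrow> nat \<Rightarrow> nat \<Rightarrow> (nat \<times> nat \<times> nat) list" where
  "front_codes m k i = map (\<lambda>n. (0, n, 0)) [0..<k - 1] @
     map (Pair 1) (List.product (remove1 i [0..<m]) [0, 1])"

definition high_codes :: "nat \<Rightarrow> nat \<Rightarrow> nat \<Rightarrow> nat \<Rightarrow> (nat \<times> nat \<times> nat) list" where
  "high_codes m k q i = front_codes m k i @ map (\<lambda>n. (2, i, n)) [0..<q]"

definition all_codes :: "nat \<Rightarrow> nat \<Rightarrow> nat \<Rightarrow> (nat \<times> nat \<times> nat) list" where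
  "all_codes m k q = map (\<lambda>n. (0, n, 0)) [0..<k - 1] @
     map (Pair 1) (List.product [0..<m] [0, 1]) @ map (Pair 2) (List.product [0..<m] [0..<q])"

text \<open>Candidate \<open>(1, i, b)\<close> wins; for \<open>i = m\<close> there is no winning candidate.\<close>

definition hard_list ::
  "(nat \<times> nat \<times> nat \<Rightarrow> 'a) \<Rightarrow> nat \<Rightarrow> nat \<Rightarrow> nat \<Rightarrow> nat \<Rightarrow> nat \<Rightarrow> nat \<Rightarrow> ('a \<times> real) list" where
  "hard_list g m k q i b j = top_list (map g (all_codes m k q))
     (map g (high_codes m k q j @ (if j = i then [(1, i, b)] else [])))"

definition hard_database ::
  "(nat \<times> nat \<times> nat \<Rightarrow> 'a) \<Rightarrow> nat \<Rightarrow> nat \<Rightarrow> nat \<Rightarrow> nat \<Rightarrow> nat \<Rightarrow> 'a database" where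
  "hard_database g m k q i b = map (hard_list g m k q i b) [0..<m]"

definition winners :: "(nat \<times> nat \<times> nat \<Rightarrow> 'a) \<Rightarrow> nat \<Rightarrow> nat \<Rightarrow> nat \<Rightarrow> 'a set" where
  "winners g k i b = g ` insert (1, i, b) ((\<lambda>n. (0, n, 0)) ` {0..<k - 1})"

lemma set_front_codes:
  "i < m \<Longrightarrow> set (front_codes m k i) =
     (\<lambda>n. (0, n, 0)) ` {0..<k - 1} \<union> {1} \<times> ({0..<m} - {i}) \<times> {0, 1}"
  by (auto simp: front_codes_def)

lemma set_high_codes:
  "i < m \<Longrightarrow> set (high_codes m k q i) = set (front_codes m k i) \<union> {2} \<times> {i} \<times> {0..<q}"
  by (auto simp: high_codes_def)

lemma set_all_codes:
  "set (all_codes m k q) =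
     (\<lambda>n. (0, n, 0)) ` {0..<k - 1} \<union> {1} \<times> {0..<m} \<times> {0, 1} \<union> {2} \<times> {0..<m} \<times> {0..<q}"
  by (auto simp: all_codes_def)

lemma distinct_all_codes: "distinct (all_codes m k q)"
  by (auto simp: all_codes_def distinct_map inj_on_def intro!: distinct_product)

lemma distinct_high_codes: "distinct (high_codes m k q i)"
  by (auto simp: high_codes_def front_codes_def distinct_map inj_on_def intro!: distinct_product)

lemma length_front_codes: "i < m \<Longrightarrow> length (front_codes m k i) = k - 1 + 2 * (m - 1)"
  by (simp add: front_codes_def length_product length_remove1)

lemma length_high_codes: "i < m \<Longrightarrow> length (high_codes m k q i) = k - 1 + 2 * (m - 1) + q"
  by (simp add: high_codes_def length_front_codes)

text \<open>In list \<open>j\<close> a candidate \<open>(1, j, c)\<close> has grade \<open>1\<close>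
  only if it is the chosen one, and hiding objects have grade \<open>1\<close> in one list only.
  This leaves the sure winners and the chosen candidate with full grade.\<close>

lemma hard_database:
  fixes m k q i b :: nat
  assumes g: "inj g" and m: "2 \<le> m" "1 \<le> k" and i: "i < m" "b < 2"
  defines "D \<equiv> hard_database g m k q i b"
  shows "D \<in> databases m k" and "objects D = g ` set (all_codes m k q)"
    and "winners g k i b = {R \<in> objects D. full_grade D R}" and "card (winners g k i b) = k"
proof -
  let ?S = "g ` set (all_codes m k q)"
  have inj: "inj_on g A" for A using g by (rule inj_on_subset) simp
  have b: "b = 0 \<or> b = 1" using i(2) by auto
  have "sorted_list (set (map g (all_codes m k q))) (hard_list g m k q i b j)" if "j < m" for j
    unfolding hard_list_def
  proof (rule sorted_list_top_list)
    show "distinct (map g (all_codes m k q))"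
      by (simp add: distinct_map inj distinct_all_codes)
    have "(1, i, b) \<notin> set (high_codes m k q i)"
      using i by (auto simp: set_high_codes set_front_codes)
    then show "distinct (map g (high_codes m k q j @ (if j = i then [(1, i, b)] else [])))"
      unfolding distinct_map using inj distinct_high_codes [of m k q j] by auto
    show "set (map g (high_codes m k q j @ (if j = i then [(1, i, b)] else []))) \<subseteq> set (map g (all_codes m k q))"
      using that i b unfolding set_map
      by (intro image_mono) (auto simp: set_high_codes set_front_codes set_all_codes)
  qed
  then have sl: "sorted_list ?S (D ! j)" if "j < m" for j
    using that by (simp add: D_def hard_database_def)
  have c: "card (winners g k i b) = k"
  proof -
    have "card ((\<lambda>n. (0 :: nat, n, 0 :: nat)) ` {0..<k - 1}) = k - 1"
      by (subst card_image) (auto simp: inj_on_def)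
    moreover have "(1 :: nat, i, b) \<notin> (\<lambda>n. (0, n, 0)) ` {0..<k - 1}" by auto
    ultimately show ?thesis
      using m unfolding winners_def by (subst card_image [OF inj]) simp
  qed
  have w: "winners g k i b \<subseteq> ?S"
    unfolding winners_def using i b by (intro image_mono) (auto simp: set_all_codes)
  have "k \<le> card ?S" using card_mono [OF _ w] c by simp
  moreover have len: "length D = m" by (simp add: D_def hard_database_def)
  moreover have "0 < m" using m by simp
  ultimately have D: "D \<in> databases m k" "objects D = ?S"
    using databasesI sl by blast+
  show "D \<in> databases m k" "objects D = ?S" by (rule D)+
  show "card (winners g k i b) = k" by (rule c)
  have full: "full_grade D (g x) \<longleftrightarrow> (\<forall>j<m. x \<in> set (high_codes m k q j) \<or> j = i \<and> x = (1, i, b))" for x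
  proof -
    have "map_of (D ! j) (g x) = Some 1 \<longleftrightarrow> x \<in> set (high_codes m k q j) \<or> j = i \<and> x = (1, i, b)"
      if "j < m" for j
      using that by (auto simp: D_def hard_database_def hard_list_def map_of_top_list
          inj_image_mem_iff [OF g] inj_eq [OF g])
    then show ?thesis by (auto simp: full_grade_def len)
  qed
  have "(\<forall>j<m. x \<in> set (high_codes m k q j) \<or> j = i \<and> x = (1, i, b)) \<longleftrightarrow>
      x \<in> insert (1, i, b) ((\<lambda>n. (0, n, 0)) ` {0..<k - 1})" (is "?l \<longleftrightarrow> ?r")
    if x: "x \<in> set (all_codes m k q)" for x
  proof
    assume l: ?l
    from x consider n where "x = (0, n, 0)" "n < k - 1" | j c where "x = (1, j, c)" "j < m"
      | j n where "x = (2, j, n)" "j < m" by (auto simp: set_all_codes)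
    then show ?r
    proof cases
      case (2 j c)
      then show ?thesis using l by (auto simp: set_high_codes set_front_codes)
    next
      case (3 j n)
      \<comment> \<open>\<open>2 \<le> m\<close> supplies a second list, where the hiding object has
        grade \<open>0\<close>.\<close>
      obtain j' where "j' < m" "j' \<noteq> j" using m that [of "if j = 0 then 1 else 0"] by (auto split: if_splits)
      with l 3 show ?thesis by (auto simp: set_high_codes set_front_codes)
    qed auto
  next
    assume ?r
    then show ?l using i b by (auto simp: set_high_codes set_front_codes)
  qed
  then have full': "full_grade D (g x) \<longleftrightarrow> x \<in> insert (1, i, b) ((\<lambda>n. (0, n, 0)) ` {0..<k - 1})"
    if "x \<in> set (all_codes m k q)" for x
    using full that by simp
  have "{R \<in> ?S. full_grade D R} = g ` {x \<in> set (all_codes m k q). full_grade D (g x)}" by blast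
  also have "\<dots> = g ` (set (all_codes m k q) \<inter> insert (1, i, b) ((\<lambda>n. (0, n, 0)) ` {0..<k - 1}))"
    using full' by (intro arg_cong [of _ _ "image g"]) blast
  also have "\<dots> = winners g k i b"
    unfolding winners_def using i b by (intro arg_cong [of _ _ "image g"]) (auto simp: set_all_codes)
  finally show "winners g k i b = {R \<in> objects D. full_grade D R}" using D by simp
qed

text \<open>Each list starts with \<open>k - 1\<close> sure winners, the candidates of the
  \<open>m - 1\<close> other lists and \<open>q\<close> hiding objects. The choice of a winner shows
  only behind these, and only in its own list.\<close>

lemma take_hard_database:
  assumes j: "j < m" and n: "n \<le> k - 1 + 2 * (m - 1) + q \<or> j \<noteq> i \<and> j \<noteq> i'"
  shows "take n (hard_database g m k q i b ! j) = take n (hard_database g m k q i' b' ! j)"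
proof (cases "n \<le> k - 1 + 2 * (m - 1) + q")
  case True
  have "take n (hard_list g m k q i b j) = map (\<lambda>X. (X, 1)) (map g (take n (high_codes m k q j)))" for i b
    using True j unfolding hard_list_def by (subst take_top_list) (simp_all add: length_high_codes take_map)
  then show ?thesis using j by (simp add: hard_database_def)
next
  case False
  with n j show ?thesis by (simp add: hard_database_def hard_list_def)
qed

text \<open>Only list \<open>i\<close> has to be read past the \<open>q\<close> hiding objects,
  which is what makes a right guess of \<open>i\<close> cheap.\<close>

lemma winners_at_top:
  assumes R: "R \<in> winners g k i b" and j: "j < m" "i < m" "b < 2"
    and n: "k - 1 + 2 * (m - 1) \<le> n" "j = i \<Longrightarrow> k - 1 + 2 * (m - 1) + q < n"
  shows "(R, 1) \<in> set (take n (hard_database g m k q i b ! j))"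
proof -
  define xs where "xs = map g (high_codes m k q j @ (if j = i then [(1, i, b)] else []))"
  let ?l = "if j = i then k - 1 + 2 * (m - 1) + q + 1 else k - 1 + 2 * (m - 1)"
  have b: "b = 0 \<or> b = 1" using j(3) by auto
  have l: "?l \<le> n" using n by auto
  have "R \<in> set (take ?l xs)"
  proof (cases "j = i")
    case True
    then have "take ?l xs = xs" using j by (simp add: xs_def length_high_codes)
    moreover have "R \<in> set xs"
      using R True j by (auto simp: xs_def winners_def set_high_codes set_front_codes)
    ultimately show ?thesis by simp
  next
    case False
    then have "take ?l xs = map g (front_codes m k j)"
      using j by (simp add: xs_def high_codes_def length_front_codes take_map)
    moreover have "R \<in> g ` set (front_codes m k j)"
      using R False j b unfolding winners_def by (auto simp: set_front_codes)
    ultimately show ?thesis by simp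
  qed
  moreover have eq: "hard_database g m k q i b ! j = top_list (map g (all_codes m k q)) xs"
    using j by (simp add: hard_database_def hard_list_def xs_def)
  moreover have "?l \<le> length xs" using j by (simp add: xs_def length_high_codes)
  ultimately have "(R, 1) \<in> set (take ?l (hard_database g m k q i b ! j))"
    unfolding eq by (subst take_top_list) auto
  moreover have "take ?l (hard_database g m k q i b ! j) = take ?l (take n (hard_database g m k q i b ! j))"
    using l by (simp add: min_def)
  ultimately show ?thesis using in_set_takeD by metis
qed

text \<open>Unless list \<open>i\<close> is read past its hiding objects, replacing the winner by
  the other candidate of that list goes unnoticed, yet it changes the unique top set. This is why
  candidates come in pairs.\<close>

lemma hard_database_depth:
  assumes t: "monotone_aggregation m t" "strict_aggregation m t"
    and g: "inj g" and m: "2 \<le> m" "1 \<le> k" and i: "i < m"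
    and B: "B \<in> correct_algorithms m k t"
    and r: "(h, Y) \<in> set_spmf (run B (hard_database g m k q i 0) [])"
  shows "k - 1 + 2 * (m - 1) + q < accesses h i"
proof (rule ccontr)
  assume a: "\<not> k - 1 + 2 * (m - 1) + q < accesses h i"
  let ?D = "hard_database g m k q i"
  note D0 = hard_database(1-3) [OF g m i, where b = 0 and q = q] hard_database(4) [OF g m i, where b = 0]
  note D1 = hard_database(1-3) [OF g m i, where b = 1 and q = q] hard_database(4) [OF g m i, where b = 1]
  have D: "?D 0 \<in> databases m k" "?D 1 \<in> databases m k" using D0 D1 by auto
  have c0: "consistent (?D 0) h" using r by (simp add: set_run_iff)
  have "consistent (?D 1) h"
  proof (rule consistent_agree [OF c0])
    show "length (?D 1) = length (?D 0)" by (simp add: hard_database_def)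
    fix j assume "j < length (?D 0)"
    then show "take (accesses h j) (?D 1 ! j) = take (accesses h j) (?D 0 ! j)"
      using a by (intro take_hard_database) (auto simp: hard_database_def)
  qed
  then have "is_top k t (?D 1) Y" "is_top k t (?D 0) Y"
    using run_certifies [OF B D(1) r] D c0 D0 D1 by (auto simp: certifies_def)
  then have "Y = winners g k i 1" "Y = winners g k i 0"
    using is_top_eq_full_grade [OF t D(2)] is_top_eq_full_grade [OF t D(1)] D0 D1 by auto
  moreover have "g (1, i, 0) \<in> winners g k i 0" "g (1, i, 0) \<notin> winners g k i 1"
    by (auto simp: winners_def inj_eq [OF g])
  ultimately show False by simp
qed


section \<open>Costs on the hard databases\<close>

text \<open>On the database in which list \<open>i\<close> hides the winner, \<open>B\<close> behaves as on the database without
  a winning candidate until it finds the winner in list \<open>i\<close>.  So if \<open>i\<close> is the list in which \<open>B\<close>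
  gets that far last, then it has read all other lists just as far before.\<close>

lemma deterministic_lower_bound:
  assumes t: "monotone_aggregation m t" "strict_aggregation m t"
    and g: "inj g" and m: "2 \<le> m" "1 \<le> k"
    and B: "B \<in> correct_algorithms m k t" "deterministic B"
  obtains i where "i < m"
    and "\<And>h Y. (h, Y) \<in> set_spmf (run B (hard_database g m k q i 0) []) \<Longrightarrow>
      m * (k - 1 + 2 * (m - 1) + q + 1) \<le> length h"
proof -
  let ?p = "k - 1 + 2 * (m - 1) + q"
  let ?D = "\<lambda>i. hard_database g m k q i 0"
  let ?N = "card (g ` set (all_codes m k q))"
  note D = hard_database(1,2) [OF g m, where b = 0 and q = q, simplified]
  \<comment> \<open>\<open>n\<close> is the time of the access that uncovers the winner, at position
    \<open>?p\<close> of list \<open>i\<close> counted from \<open>0\<close>.\<close>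
  have ex: "\<exists>h Y n. (h, Y) \<in> set_spmf (run B (?D i) []) \<and> n < length h \<and> fst (h ! n) = i \<and>
      accesses (take n h) i = ?p" if "i < m" for i
  proof -
    have "lossless_spmf (run B (?D i) [])" using B(1) D(1) [OF that] by (simp add: correct_algorithms_def)
    then obtain h Y where r: "(h, Y) \<in> set_spmf (run B (?D i) [])" using lossless_support by fastforce
    from ex_access [OF hard_database_depth [OF t g m that B(1) this]] r show ?thesis by blast
  qed
  then obtain h Y n where hYn: "\<And>i. i < m \<Longrightarrow> (h i, Y i) \<in> set_spmf (run B (?D i) []) \<and> n i < length (h i) \<and>
      fst (h i ! n i) = i \<and> accesses (take (n i) (h i)) i = ?p"
    by metis
  have r: "consistent (?D i) (h i)" "follows B ?N (h i)" "Output (Y i) \<in> set_pmf (B ?N (h i))"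
    and n: "n i < length (h i)" "fst (h i ! n i) = i" "accesses (take (n i) (h i)) i = ?p" if "i < m" for i
    using hYn [OF that] D(2) [OF that] by (simp_all add: set_run_iff)
  define P where "P i = take (n i) (h i)" for i
  have lP: "length (P i) = n i" if "i < m" for i using n [OF that] by (simp add: P_def)
  \<comment> \<open>The runs are on different databases, but before the discovery each looks like a
    run on \<open>?D m\<close>, which has no winning candidate. This makes the prefixes
    comparable.\<close>
  have P: "consistent (?D m) (P i)" "follows B ?N (P i)" "Access i \<in> set_pmf (B ?N (P i))" if i: "i < m" for i
  proof -
    show "consistent (?D m) (P i)"
    proof (rule consistent_agree [OF consistent_take [OF r(1) [OF i], of "n i", folded P_def]])
      fix j assume "j < length (?D i)"
      then have j: "j < m" by (simp add: hard_database_def)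
      have "accesses (P i) i = ?p" using n [OF i] by (simp add: P_def)
      with j show "take (accesses (P i) j) (?D m ! j) = take (accesses (P i) j) (?D i ! j)"
        by (intro take_hard_database) auto
    qed (simp add: hard_database_def)
    show "follows B ?N (P i)" using r(2) [OF i] n [OF i] by (auto simp: follows_def P_def min_def)
    show "Access i \<in> set_pmf (B ?N (P i))" using r(2) [OF i] n [OF i] by (auto simp: follows_def P_def)
  qed
  have "Max (n ` {..<m}) \<in> n ` {..<m}" using m by (intro Max_in) (auto simp: lessThan_empty_iff)
  then obtain i where i: "i < m" and ni: "n i = Max (n ` {..<m})" by auto
  have other: "?p + 1 \<le> accesses (P i) j" if j: "j < m" "j \<noteq> i" for j
  proof -
    have "n j \<le> n i" unfolding ni using j by simp
    then have pre: "take (n j) (P i) = P j"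
      using deterministic_prefix [OF B(2) P(1,2) [OF j(1)] P(1,2) [OF i]] by (simp add: lP i j)
    \<comment> \<open>Otherwise \<open>B\<close> would access two different lists after the same
      history.\<close>
    have "n j \<noteq> n i"
    proof
      assume "n j = n i"
      then have "P i = P j" using pre lP [OF i] by simp
      then have "Access i = (Access j :: 'a action)"
        using P(3) [OF i] P(3) [OF j(1)] deterministic_action [OF B(2)] by metis
      with j show False by simp
    qed
    with \<open>n j \<le> n i\<close> have lt: "n j < length (P i)" by (simp add: lP i)
    then have "Access (fst (P i ! n j)) \<in> set_pmf (B ?N (P j))"
      using P(2) [OF i] pre by (auto simp: follows_def)
    then have "Access (fst (P i ! n j)) = (Access j :: 'a action)"
      using P(3) [OF j(1)] deterministic_action [OF B(2)] by metis
    then have "accesses (take (Suc (n j)) (P i)) j = ?p + 1"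
      using lt n [OF j(1)] by (simp add: take_Suc_conv_app_nth pre P_def [of j])
    then show ?thesis using accesses_take_le [of "Suc (n j)" "P i" j] by simp
  qed
  \<comment> \<open>With the access at time \<open>n i\<close>, the last list reaches depth
    \<open>?p + 1\<close>.\<close>
  have "m * (?p + 1) = (\<Sum>j<m. ?p + 1)" by simp
  also have "\<dots> \<le> (\<Sum>j<m. accesses (take (Suc (n i)) (h i)) j)"
  proof (rule sum_mono)
    fix j assume "j \<in> {..<m}"
    then have j: "j < m" by simp
    show "?p + 1 \<le> accesses (take (Suc (n i)) (h i)) j"
      using n [OF i] other [OF j] by (cases "j = i") (auto simp: take_Suc_conv_app_nth P_def)
  qed
  also have "\<dots> \<le> length (take (Suc (n i)) (h i))" by (rule sum_accesses_le_length)
  also have "\<dots> \<le> length (h i)" by simp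
  finally have len: "m * (?p + 1) \<le> length (h i)" .
  show thesis
  proof
    fix h' Y' assume "(h', Y') \<in> set_spmf (run B (?D i) [])"
    then have r': "consistent (?D i) h'" "follows B ?N h'" "Output Y' \<in> set_pmf (B ?N h')"
      using D(2) [OF i] by (simp_all add: set_run_iff)
    \<comment> \<open>The bound was shown for one outcome. A shorter one would be a prefix of it
      after which \<open>B\<close> both halts and makes an access.\<close>
    have "length (h i) \<le> length h'"
    proof (rule ccontr)
      assume a: "\<not> length (h i) \<le> length h'"
      then have "take (length h') (h i) = h'"
        using deterministic_prefix [OF B(2) r'(1,2) r(1,2) [OF i]] by simp
      then have "Access (fst (h i ! length h')) \<in> set_pmf (B ?N h')"
        using r(2) [OF i] a unfolding follows_def by (metis not_le)
      with r'(3) deterministic_action [OF B(2)] show False by blast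
    qed
    with len show "m * (?p + 1) \<le> length h'" by simp
  qed (rule i)
qed

lemma hard_database_upper_bound:
  fixes cS :: real and g :: "nat \<times> nat \<times> nat \<Rightarrow> 'a"
  assumes t: "monotone_aggregation m t" "strict_aggregation m t"
    and g: "inj g" and m: "2 \<le> m" "1 \<le> k" and i: "i < m" and "0 \<le> cS"
  obtains A where "A \<in> correct_algorithms m k t"
    and "cost cS A (hard_database g m k q i 0) \<le> ennreal (real (m * (k - 1 + 2 * (m - 1)) + q + 1) * cS)"
proof
  let ?K = "k - 1 + 2 * (m - 1)"
  let ?D = "hard_database g m k q i 0"
  define n where "n = m * ?K + q + 1"
  \<comment> \<open>Round-robin through the first \<open>?K\<close> entries of each list, then
    \<open>q + 1\<close> accesses to the guessed list \<open>i\<close>. The return to round-robin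
    ensures correctness on all other databases.\<close>
  define f where "f j = (if m * ?K \<le> j \<and> j < n then i else j mod m)" for j
  note D = hard_database [OF g m i, where b = 0, simplified]
  show "certifying_algorithm m k t f \<in> correct_algorithms m k t"
  proof (rule certifying_algorithm_correct, intro exI allI impI)
    fix N j assume j: "j < m"
    \<comment> \<open>Of \<open>N + n\<close> round-robin visits to list \<open>j\<close>, at most
      \<open>n\<close> fall among the first \<open>n\<close> positions, where \<open>f\<close> may
      deviate.\<close>
    let ?X = "{l. l < m * (N + n) \<and> l mod m = j}"
    have "N \<le> card ?X - card {..<n}" using card_mod_eq [OF j] by simp
    also have "\<dots> \<le> card (?X - {..<n})" by (rule diff_card_le_card_Diff) simp
    also have "\<dots> \<le> card {l. l < m * (N + n) \<and> f l = j}"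
      by (rule card_mono) (auto simp: f_def)
    finally show "N \<le> card {l. l < m * (N + n) \<and> f l = j}" .
  qed
  let ?h = "static_history ?D f n"
  have K: "?K \<le> accesses ?h j" if "j < m" for j
  proof -
    have "?K = card {l. l < m * ?K \<and> l mod m = j}" using card_mod_eq [OF that] by simp
    also have "\<dots> \<le> card {l. l < n \<and> f l = j}"
      by (rule card_mono) (auto simp: f_def n_def)
    finally show ?thesis by (simp add: accesses_static_history)
  qed
  have "?K + (q + 1) = card ({l. l < m * ?K \<and> l mod m = i} \<union> {m * ?K..<n})"
    by (subst card_Un_disjoint) (auto simp: card_mod_eq [OF i] n_def)
  also have "\<dots> \<le> card {l. l < n \<and> f l = i}"
    by (rule card_mono) (auto simp: f_def n_def)
  finally have Kq: "?K + q < accesses ?h i" by (simp add: accesses_static_history)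
  have "certifies m k t (card (objects ?D)) ?h (winners g k i 0)"
    using K Kq m by (intro certifies_full_grade [OF t D(1) consistent_static_history D(4)] winners_at_top i)
      auto
  then show "cost cS (certifying_algorithm m k t f) ?D \<le> ennreal (real (m * ?K + q + 1) * cS)"
    using certifying_algorithm_cost \<open>0 \<le> cS\<close> unfolding n_def by blast
qed

text \<open>\<open>B\<close> needs at least \<open>m * q\<close> accesses where some competitor
  needs \<open>q\<close> plus a constant. As \<open>q\<close> grows, every ratio below
  \<open>m\<close> fails.\<close>

lemma not_instance_optimal:
  fixes B :: "'a algorithm" and cS c :: real
  assumes inf: "infinite (UNIV :: 'a set)" and t: "monotone_aggregation m t" "strict_aggregation m t"
    and m: "2 \<le> m" "1 \<le> k" and "0 < cS" and B: "deterministic B" and c: "c < real m"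
  shows "\<not> instance_optimal (cost cS) (correct_algorithms m k t) (databases m k) c B"
proof
  assume "instance_optimal (cost cS) (correct_algorithms m k t) (databases m k) c B"
  then obtain c' where BA: "B \<in> correct_algorithms m k t"
    and opt: "\<And>A D. A \<in> correct_algorithms m k t \<Longrightarrow> D \<in> databases m k \<Longrightarrow>
      cost cS B D \<le> ennreal c * cost cS A D + ennreal c'"
    unfolding instance_optimal_def by blast
  obtain g0 :: "nat \<Rightarrow> 'a" where "inj g0" using infinite_countable_subset [OF inf] by auto
  then have g: "inj (g0 \<circ> to_nat :: nat \<times> nat \<times> nat \<Rightarrow> 'a)" by (simp add: inj_compose)
  let ?g = "g0 \<circ> to_nat :: nat \<times> nat \<times> nat \<Rightarrow> 'a"
  let ?K = "k - 1 + 2 * (m - 1)"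
  \<comment> \<open>\<open>ennreal\<close> sends negative reals to \<open>0\<close>, so clipping
    keeps the inequality and allows real arithmetic.\<close>
  define c1 where "c1 = max c 0"
  define c2 where "c2 = max c' 0"
  have c1: "0 \<le> c1" "c1 < m" "ennreal c = ennreal c1" using c m by (auto simp: c1_def max_def ennreal_neg)
  have c2: "0 \<le> c2" "ennreal c' = ennreal c2" by (auto simp: c2_def max_def ennreal_neg)
  have bound: "real m * (real q * cS) \<le> c1 * (real (m * ?K + q + 1) * cS) + c2" for q
  proof -
    obtain i where i: "i < m" and low: "\<And>h Y. (h, Y) \<in> set_spmf (run B (hard_database ?g m k q i 0) []) \<Longrightarrow>
      m * (?K + q + 1) \<le> length h"
      using deterministic_lower_bound [OF t g m BA B] by blast
    let ?D = "hard_database ?g m k q i 0"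
    have D: "?D \<in> databases m k" using hard_database(1) [OF g m i] by simp
    obtain A where A: "A \<in> correct_algorithms m k t" "cost cS A ?D \<le> ennreal (real (m * ?K + q + 1) * cS)"
      using hard_database_upper_bound [OF t g m i, of cS] \<open>0 < cS\<close> by (metis less_imp_le)
    have "ennreal (real m * (real q * cS)) \<le> ennreal 1 * cost cS B ?D + ennreal 0"
    proof (rule cost_ge)
      show "lossless_spmf (run B ?D [])" using BA D by (simp add: correct_algorithms_def)
      fix h Y assume "(h, Y) \<in> set_spmf (run B ?D [])"
      then have "m * q \<le> length h" using low order_trans by (fastforce simp: algebra_simps)
      then have "real m * real q \<le> real (length h)" by (metis of_nat_le_iff of_nat_mult)
      then show "real m * (real q * cS) \<le> 1 * (length h * cS) + 0"
        using \<open>0 < cS\<close> by (simp add: mult.assoc [symmetric])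
    qed (use \<open>0 < cS\<close> in auto)
    also have "\<dots> \<le> ennreal c1 * cost cS A ?D + ennreal c2"
      using opt [OF A(1) D] c1 c2 by simp
    also have "\<dots> \<le> ennreal c1 * ennreal (real (m * ?K + q + 1) * cS) + ennreal c2"
      by (intro add_mono mult_left_mono A(2)) auto
    also have "\<dots> = ennreal (c1 * (real (m * ?K + q + 1) * cS) + c2)"
      using c1 c2 \<open>0 < cS\<close> by (simp add: ennreal_mult ennreal_plus)
    finally show ?thesis
      using c1 c2 \<open>0 < cS\<close> by (subst (asm) ennreal_le_iff) auto
  qed
  let ?b = "c1 * (real (m * ?K + 1) * cS) + c2"
  \<comment> \<open>\<open>?b\<close> collects what does not grow with \<open>q\<close>; the
    coefficient of \<open>q\<close> is positive because \<open>c1 < m\<close>.\<close>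
  obtain q :: nat where q: "?b < real q * ((real m - c1) * cS)"
    using reals_Archimedean3 [of "(real m - c1) * cS"] c1 \<open>0 < cS\<close> by auto
  have "real m * (real q * cS) \<le> ?b + c1 * (real q * cS)"
    using bound [of q] by (simp add: algebra_simps)
  with q show False by (simp add: algebra_simps)
qed

text \<open>For \<open>m = 1\<close>, NRA halts after \<open>k\<close> accesses, so the additive
  constant absorbs its cost; hence the restriction \<open>2 \<le> m\<close> in the second
  claim.\<close>

theorem corollary8p6:
  fixes m k :: nat and cS :: real and t :: "real list \<Rightarrow> real"
  assumes "infinite (UNIV :: 'a set)"
    and "1 \<le> m" and "1 \<le> k" and "0 < cS"
    and "aggregation_function m t"
    and "monotone_aggregation m t"
    and "strict_aggregation m t"
  shows "(\<forall>T :: nat \<Rightarrow> 'a history \<Rightarrow> 'a set. T_rule m k t T \<longrightarrow>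
            instance_optimal (cost cS) (correct_algorithms m k t) (databases m k) (real m)
              (NRA m k t T)) \<and>
         (2 \<le> m \<longrightarrow>
           (\<forall>(B :: 'a algorithm) c. deterministic B \<and> c < real m \<longrightarrow>
              \<not> instance_optimal (cost cS) (correct_algorithms m k t) (databases m k) c B))"
  using NRA_instance_optimal not_instance_optimal assms by blast

end
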